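(* Let $n\ge1$ be an integer, $\alpha\in(0,2)$ and $\nu>0$. For every integer $N\ge1$, as $r\to\infty$ (that is, for all sufficiently large $r$), $$q_{\alpha,\nu,n}(r)=\frac{1}{\pi^{\frac{n+2}{2}}}\sum_{j=1}^{N-1}\frac{(-1)^{j-1}}{j!}\frac{\Gamma(\nu+j)}{\Gamma(\nu)}\sin\frac{\pi\alpha j}{2}\,2^{\alpha j}\,\Gamma\left(\frac{n+\alpha j}{2}\right)\Gamma\left(\frac{2+\alpha j}{2}\right)r^{-\alpha j-n}+\mathcal{R}_N(r),$$ where $$|\mathcal{R}_N(r)|\le\frac{2^{\alpha N}\,\Gamma(N+\nu)\,\Gamma\left(\frac{n+\alpha N}{2}\right)\Gamma\left(\frac{2+\alpha N}{2}\right)}{\pi^{\frac{n+2}{2}}\,N!\,\Gamma(\nu)\,\left(\sin\frac{\pi\alpha}{2}\right)^{\nu+N}}\,r^{-\alpha N-n}.$$ In particular, the leading term as $r\to\infty$ is $$q_{\alpha,\nu,n}(r)\sim\frac{2^\alpha\nu}{\pi^{\frac{n+2}{2}}}\sin\frac{\pi\alpha}{2}\,\Gamma\left(\frac{n+\alpha}{2}\right)\Gamma\left(\frac{2+\alpha}{2}\right)r^{-\alpha-n}.$$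
   Context: $\Vert\cdot\Vert$ is the Euclidean norm on $\mathbb{R}^n$. For an integer $n\ge1$, $\alpha\in(0,2]$, $\nu>0$, $p_{\alpha,\nu,n}$ denotes the probability density function on $\mathbb{R}^n$ whose characteristic function is $\int_{\mathbb{R}^n}e^{i\mathbf{x}\cdot\boldsymbol{t}}p_{\alpha,\nu,n}(\mathbf{x})\,d^n\mathbf{x}=(1+\Vert\boldsymbol{t}\Vert^\alpha)^{-\nu}$ for all $\boldsymbol{t}\in\mathbb{R}^n$. It is a radial function; one takes the version which is continuous on $\mathbb{R}^n\setminus\{\mathbf{0}\}$, and $q_{\alpha,\nu,n}(r)$, $r>0$, denotes the value of $p_{\alpha,\nu,n}(\mathbf{x})$ at points with $\Vert\mathbf{x}\Vert=r$. $f\sim g$ means $f/g\to1$. Empty sums are zero. *)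

theory Defs
  imports "HOL-Probability.Probability" "HOL-Library.Landau_Symbols"
begin

text \<open>
  \<open>linnik_density \<alpha> \<nu> p\<close>: the function \<open>p\<close> is the density \<open>p\<^bsub>\<alpha>,\<nu>,n\<^esub>\<close> on \<open>\<real>\<^sup>n\<close>, \<open>n = CARD('n)\<close>.
  The last conjunct selects the version continuous away from the origin; the value
  at the origin, where the density may be unbounded, is left arbitrary.
\<close>

definition linnik_density :: "real \<Rightarrow> real \<Rightarrow> (real ^ 'n \<Rightarrow> real) \<Rightarrow> bool" where
  "linnik_density \<alpha> \<nu> p \<longleftrightarrow>
     p \<in> borel_measurable lborel \<and>
     (\<forall>x. 0 \<le> p x) \<and>
     prob_space (density lborel (\<lambda>x. ennreal (p x))) \<and>
     (\<forall>t. (LINT x|lborel. exp (\<i> * complex_of_real (x \<bullet> t)) * complex_of_real (p x))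
            = complex_of_real ((1 + norm t powr \<alpha>) powr (- \<nu>))) \<and>
     continuous_on (- {0}) p"

text \<open>
  The common value of a radial function on the sphere of radius \<open>r\<close>; meaningful for
  \<open>r > 0\<close> only if the function is constant there.
\<close>

definition radial_part :: "(real ^ 'n \<Rightarrow> real) \<Rightarrow> real \<Rightarrow> real" where
  "radial_part p r = (THE y. \<forall>x. norm x = r \<longrightarrow> p x = y)"

end

theory Submission
  imports Defs "HOL-Complex_Analysis.Complex_Analysis" "HOL-Real_Asymp.Real_Asymp"
begin

text \<open>
  Put \<open>\<beta> = \<alpha> / 2 < 1\<close>. The function \<open>s \<mapsto> (1 + s\<^sup>\<beta>)\<^sup>-\<^sup>\<nu>\<close> is analytic in the plane cut along the negative
  axis, so Cauchy's theorem writes it as \<open>\<integral> \<rho>(v) / (s + v) dv\<close> over \<open>v > 0\<close>, where \<open>\<rho>\<close> is its jump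
  across the cut divided by \<open>2 \<pi> i\<close>. Hence it is the Laplace transform of \<open>m(\<tau>) = \<integral> \<rho>(v) exp (- \<tau> v) dv\<close>. Taking
  \<open>s = \<parallel>t\<parallel>\<^sup>2\<close>, where \<open>exp (- \<tau> \<parallel>t\<parallel>\<^sup>2)\<close> is the Fourier transform of the heat kernel at time \<open>\<tau>\<close>, and
  inverting the Fourier transform shows that \<open>p\<close> is the mixture of heat kernels with weight \<open>m\<close>.
  Taylor's formula with Lagrange remainder for the imaginary part of \<open>\<sigma> \<mapsto> (1 + \<sigma> z)\<^sup>-\<^sup>\<nu>\<close>, with
  \<open>z = v\<^sup>\<beta> exp (i \<pi> \<beta>)\<close> and \<open>\<bar>1 + \<sigma> z\<bar> \<ge> sin (\<pi> \<beta>)\<close>, expands \<open>\<rho>\<close> in powers of \<open>v\<^sup>\<beta>\<close>. Every power integrates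
  to a product of two Gamma functions, and so does the remainder. Half lines are parametrized by
  the exponential (\<open>v = exp u\<close>, \<open>\<tau> = exp w\<close>), so that all integrals are over the whole real line.
\<close>

subsection \<open>Gamma integral and binomial expansion\<close>

text \<open>The substitution \<open>t = c * exp w\<close> in Euler's integral for
  \<open>Gamma b\<close>; the Jacobian raises the exponent of \<open>t\<close> from
  \<open>b - 1\<close> to \<open>b\<close>. The Gamma factors of the expansion that depend on
  \<open>\<alpha>\<close> come from this formula, which also supplies integrable majorants.\<close>

lemma exp_Gamma_integral:
  fixes b c :: real
  assumes "0 < b" "0 < c"
  shows "has_bochner_integral lborel (\<lambda>w. exp (b * w - c * exp w)) (Gamma b * c powr (- b))"
proof -
  let ?f = "\<lambda>t::real. t powr (b - 1) / exp t"
  have "((\<lambda>t. if t \<in> {0<..} then ?f t else 0) has_integral Gamma b) {0..}"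
    by (rule has_integral_spike[of "{0}", rotated 2, OF Gamma_integral_real[OF assms(1)]]) auto
  then have "(?f has_integral Gamma b) {0<..}"
    by (subst (asm) has_integral_restrict) auto
  then have f: "?f absolutely_integrable_on {0<..}" "integral {0<..} ?f = Gamma b"
    by (auto intro!: nonnegative_absolutely_integrable_1 simp: has_integral_iff)
  have im: "range (\<lambda>w. c * exp w) = {0<..}"
  proof -
    have "y = c * exp (ln (y / c))" if "0 < y" for y
      using that assms by simp
    then have "y \<in> range (\<lambda>w. c * exp w)" if "0 < y" for y
      using that by blast
    then show ?thesis using assms by auto
  qed
  let ?g = "\<lambda>w. \<bar>c * exp w\<bar> * ?f (c * exp w)"
  have "?g absolutely_integrable_on UNIV \<and> integral UNIV ?g = Gamma b"
    by (subst has_absolute_integral_change_of_variables_1')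
       (use f assms in \<open>auto simp: im inj_on_def intro!: derivative_eq_intros\<close>)
  moreover have g: "?g w = c powr b * exp (b * w - c * exp w)" for w
    using assms by (simp add: powr_def ln_mult exp_add exp_diff algebra_simps)
  ultimately have g': "(\<lambda>w. c powr b * exp (b * w - c * exp w)) absolutely_integrable_on UNIV"
    "integral UNIV (\<lambda>w. c powr b * exp (b * w - c * exp w)) = Gamma b"
    by simp_all
  have h: "integrable lebesgue (\<lambda>w. c powr b * exp (b * w - c * exp w))"
    using g'(1) by (simp add: set_integrable_def)
  have h': "(LINT w|lebesgue. c powr b * exp (b * w - c * exp w)) = Gamma b"
    using g'(2) by (subst integral_lebesgue[OF h, symmetric])
  have "integrable lborel (\<lambda>w. c powr b * exp (b * w - c * exp w))"
    using h by (subst (asm) integrable_completion) auto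
  moreover have "(LINT w|lborel. c powr b * exp (b * w - c * exp w)) = Gamma b"
    using h' by (subst (asm) integral_completion) auto
  ultimately have "has_bochner_integral lborel (\<lambda>w. c powr b * exp (b * w - c * exp w)) (Gamma b)"
    by (simp add: has_bochner_integral_iff)
  then have "has_bochner_integral lborel (\<lambda>w. c powr (- b) * (c powr b * exp (b * w - c * exp w))) (c powr (- b) * Gamma b)"
    by (rule has_bochner_integral_mult_right)
  moreover have "c powr (- b) * (c powr b * y) = y" for y
    using assms by (simp add: powr_minus)
  ultimately show ?thesis by (simp add: mult.commute)
qed

text \<open>For real \<open>x\<close> the points \<open>1 + x * cis \<theta>\<close> form the line
  through 1 with direction \<open>cis \<theta>\<close>, and its distance from the origin is the
  absolute value of \<open>sin \<theta>\<close>. Completing the square makes this visible.\<close>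

lemma sin_le_norm_one_plus_cis:
  assumes "0 \<le> sin \<theta>"
  shows "sin \<theta> \<le> norm (1 + complex_of_real x * cis \<theta>)"
proof -
  have "(sin \<theta>)\<^sup>2 \<le> (x + cos \<theta>)\<^sup>2 + (sin \<theta>)\<^sup>2" by simp
  also have "\<dots> = (1 + x * cos \<theta>)\<^sup>2 + (x * sin \<theta>)\<^sup>2"
    using sin_cos_squared_add[of \<theta>] by algebra
  finally show ?thesis
    unfolding cmod_def by (intro real_le_rsqrt) (simp add: power_mult_distrib)
qed

lemma norm_powr_minus_of_real: "norm (z powr (- complex_of_real a)) = norm z powr (- a)"
  by (simp add: norm_powr_real_powr')

text \<open>Lagrange's form of the remainder is available for real functions only, so the imaginary
  part is taken before expanding. This gives the remainder the constant of the next binomial term,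
  up to a power of \<open>sin \<theta>\<close>.\<close>

lemma Im_powr_binomial_remainder:
  fixes \<nu> \<theta> x :: real
  assumes "0 < \<nu>" "0 < \<theta>" "\<theta> < pi" "0 < N"
  shows "\<bar>Im ((1 + x * cis \<theta>) powr (- complex_of_real \<nu>)) -
           (\<Sum>j<N. (- 1) ^ j * pochhammer \<nu> j / fact j * x ^ j * sin (j * \<theta>))\<bar>
         \<le> pochhammer \<nu> N / fact N * \<bar>x\<bar> ^ N * sin \<theta> powr (- (\<nu> + N))"
proof -
  define z where "z = x * cis \<theta>"
  have s: "0 < sin \<theta>" using assms by (simp add: sin_gt_zero)
  \<comment> \<open>The imaginary part \<open>s * x * sin \<theta>\<close> vanishes only when
    \<open>s * x = 0\<close>, and then the value is 1. So the principal power is differentiable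
    along the whole real line of the parameter.\<close>
  have nz: "1 + of_real s * z \<notin> \<real>\<^sub>\<le>\<^sub>0" for s
    using s by (auto simp: z_def complex_nonpos_Reals_iff)
  \<comment> \<open>\<open>d j\<close> is the j-th derivative of the imaginary part of
    \<open>(1 + s * z) powr (- \<nu>)\<close> with respect to \<open>s\<close>; the sign and the
    Pochhammer symbol come from differentiating the power.\<close>
  define d where "d = (\<lambda>(j::nat) s. Im ((- 1) ^ j * of_real (pochhammer \<nu> j) * z ^ j *
      (1 + of_real s * z) powr (- of_real (\<nu> + j))))"
  have der: "(d j has_real_derivative d (Suc j) s) (at s)" for j s
  proof -
    define w where "w = complex_of_real (\<nu> + j)"
    have w: "- complex_of_real (\<nu> + Suc j) = - w - 1" "pochhammer \<nu> (Suc j) = w * pochhammer \<nu> j"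
      by (simp_all add: w_def pochhammer_Suc)
    have "((\<lambda>s. (- 1) ^ j * of_real (pochhammer \<nu> j) * z ^ j *
      (1 + s * z) powr (- of_real (\<nu> + j))) has_field_derivative
      ((- 1) ^ Suc j * of_real (pochhammer \<nu> (Suc j)) * z ^ Suc j *
      (1 + of_real s * z) powr (- of_real (\<nu> + Suc j)))) (at (of_real s))"
      using nz[of s]
      unfolding w w_def[symmetric] by (auto intro!: derivative_eq_intros)
    from bounded_linear.has_vector_derivative[OF bounded_linear_Im has_vector_derivative_real_field[OF this]]
    show ?thesis
      unfolding d_def has_real_derivative_iff_has_vector_derivative by simp
  qed
  from Maclaurin[of 1 N d "d 0"] der assms(4) obtain t where
    t: "d 0 1 = (\<Sum>m<N. d m 0 / fact m) + d N t / fact N"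
    by auto
  have d0: "d j 0 = (- 1) ^ j * pochhammer \<nu> j * x ^ j * sin (j * \<theta>)" for j
  proof -
    have "d j 0 = Im (of_real ((- 1) ^ j * pochhammer \<nu> j * x ^ j) * cis \<theta> ^ j)"
      by (simp add: d_def z_def power_mult_distrib mult.assoc)
    also have "\<dots> = (- 1) ^ j * pochhammer \<nu> j * x ^ j * Im (cis \<theta> ^ j)"
      by (subst times_complex.sel(2)) (simp del: of_real_mult of_real_power)
    also have "Im (cis \<theta> ^ j) = sin (j * \<theta>)"
      by (rule sin_n_Im_cis_pow_n[symmetric])
    finally show ?thesis .
  qed
  have "\<bar>d N t\<bar> \<le> norm ((- 1) ^ N * of_real (pochhammer \<nu> N) * z ^ N *
      (1 + of_real t * z) powr (- of_real (\<nu> + N)))"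
    unfolding d_def by (rule abs_Im_le_cmod)
  also have "\<dots> = pochhammer \<nu> N * \<bar>x\<bar> ^ N * norm (1 + of_real t * z) powr (- (\<nu> + N))"
    using pochhammer_nonneg[OF assms(1), of N]
    unfolding norm_mult norm_power norm_powr_minus_of_real by (simp add: z_def norm_mult)
  \<comment> \<open>The lower bound \<open>sin \<theta>\<close> holds at every real
    \<open>t\<close>, wherever the intermediate point lies; the negative exponent reverses the
    inequality.\<close>
  also have "\<dots> \<le> pochhammer \<nu> N * \<bar>x\<bar> ^ N * sin \<theta> powr (- (\<nu> + N))"
    using sin_le_norm_one_plus_cis[of \<theta> "t * x"] s assms pochhammer_nonneg[OF assms(1), of N]
    by (intro mult_left_mono powr_mono2') (auto simp: z_def mult.assoc)
  finally have dN: "\<bar>d N t\<bar> / fact N \<le> pochhammer \<nu> N * \<bar>x\<bar> ^ N * sin \<theta> powr (- (\<nu> + N)) / fact N"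
    by (rule divide_right_mono) simp
  have "d 0 1 = Im ((1 + x * cis \<theta>) powr (- complex_of_real \<nu>))"
    by (simp add: d_def z_def)
  moreover have "(\<Sum>j<N. (- 1) ^ j * pochhammer \<nu> j / fact j * x ^ j * sin (j * \<theta>)) =
      (\<Sum>m<N. d m 0 / fact m)"
    unfolding d0 by (rule sum.cong) simp_all
  ultimately have "Im ((1 + x * cis \<theta>) powr (- complex_of_real \<nu>)) -
      (\<Sum>j<N. (- 1) ^ j * pochhammer \<nu> j / fact j * x ^ j * sin (j * \<theta>)) = d N t / fact N"
    using t by linarith
  then have "\<bar>Im ((1 + x * cis \<theta>) powr (- complex_of_real \<nu>)) -
      (\<Sum>j<N. (- 1) ^ j * pochhammer \<nu> j / fact j * x ^ j * sin (j * \<theta>))\<bar> = \<bar>d N t\<bar> / fact N"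
    by simp
  with dN show ?thesis by simp
qed

subsection \<open>Stieltjes representation\<close>

lemma contour_integral_linepath_same_Im:
  assumes "a < b"
  shows "contour_integral (linepath (Complex a c) (Complex b c)) f = integral {a..b} (\<lambda>x. f (Complex x c))"
proof -
  have lp: "linepath (Complex a c) (Complex b c) x = Complex (linepath a b x) c" for x
    by (simp add: complex_eq_iff linepath_def algebra_simps)
  have "contour_integral (linepath (Complex a c) (Complex b c)) f =
      (Complex b c - Complex a c) * integral {0..1} (\<lambda>x. f (linepath (Complex a c) (Complex b c) x))"
    by (simp add: contour_integral_integral)
  also have "Complex b c - Complex a c = of_real (b - a)"
    by (simp add: complex_eq_iff)
  also have "(\<lambda>x. f (linepath (Complex a c) (Complex b c) x)) = (\<lambda>x. f (Complex (linepath a b x) c))"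
    unfolding lp ..
  also have "integral {0..1} (\<lambda>x. f (Complex (linepath a b x) c)) =
      integral {0..(b - a) / (b - a)} (\<lambda>x. f (Complex (a + (b - a) * x) c))"
    using assms by (simp add: algebra_simps linepath_def)
  also have "{0..(b - a) / (b - a)} = (\<lambda>x. x / (b - a)) ` {0..b - a}"
    using assms by simp
  also have "integral \<dots> (\<lambda>x. f (Complex (a + (b - a) * x) c)) =
      integral {a - a..b - a} (\<lambda>x. f (Complex (x + a) c)) / of_real (b - a)"
    using assms by (subst integral_stretch_real) (auto simp: scaleR_conv_of_real add_ac)
  also have "\<dots> = integral {a..b} (\<lambda>x. f (Complex x c)) / of_real (b - a)"
    by (subst integral_shift_real_ivl) (rule refl)
  finally show ?thesis using assms by simp
qed

text \<open>Only the horizontal sides become real integrals: they will run along the two edges of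
  the cut and carry the jump, whereas the vertical sides are merely estimated later. The top side is
  traversed from right to left, hence its minus sign.\<close>

lemma contour_integral_rectpath:
  assumes f: "f holomorphic_on U" "open U" and ab: "Re a < Re b" "Im a < Im b"
    and U: "path_image (rectpath a b) \<subseteq> U"
  shows "contour_integral (rectpath a b) f =
    integral {Re a..Re b} (\<lambda>x. f (Complex x (Im a))) - integral {Re a..Re b} (\<lambda>x. f (Complex x (Im b)))
    + contour_integral (linepath (Complex (Re b) (Im a)) b) f
    + contour_integral (linepath (Complex (Re a) (Im b)) a) f"
proof -
  have sub: "closed_segment a (Complex (Re b) (Im a)) \<subseteq> U" "closed_segment (Complex (Re b) (Im a)) b \<subseteq> U"
    "closed_segment b (Complex (Re a) (Im b)) \<subseteq> U" "closed_segment (Complex (Re a) (Im b)) a \<subseteq> U"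
    using U by (auto simp: rectpath_def Let_def path_image_join)
  note ci = contour_integrable_holomorphic_simple[OF f valid_path_linepath, unfolded path_image_linepath]
  have "contour_integral (rectpath a b) f = contour_integral (linepath a (Complex (Re b) (Im a))) f
     + (contour_integral (linepath (Complex (Re b) (Im a)) b) f
     + (contour_integral (linepath b (Complex (Re a) (Im b))) f
     + contour_integral (linepath (Complex (Re a) (Im b)) a) f))"
    by (simp add: rectpath_def Let_def contour_integrable_joinI valid_path_join ci sub)
  also have "contour_integral (linepath a (Complex (Re b) (Im a))) f = integral {Re a..Re b} (\<lambda>x. f (Complex x (Im a)))"
    using contour_integral_linepath_same_Im[OF ab(1), of "Im a" f] by simp
  also have "contour_integral (linepath b (Complex (Re a) (Im b))) f = - integral {Re a..Re b} (\<lambda>x. f (Complex x (Im b)))"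
    using contour_integral_linepath_same_Im[OF ab(1), of "Im b" f]
      contour_integral_reverse_linepath[OF
        continuous_on_subset[OF holomorphic_on_imp_continuous_on[OF f(1)] sub(3)]]
    by simp
  finally show ?thesis by (simp add: algebra_simps)
qed

text \<open>In this strip \<open>sin (Im w)\<close> vanishes only for \<open>Im w = 0\<close>, where
  \<open>1 + exp w\<close> is positive.\<close>

lemma one_plus_exp_not_nonpos:
  assumes "\<bar>Im w\<bar> < pi"
  shows "1 + exp w \<notin> \<real>\<^sub>\<le>\<^sub>0"
proof
  assume "1 + exp w \<in> \<real>\<^sub>\<le>\<^sub>0"
  then have *: "1 + exp (Re w) * cos (Im w) \<le> 0" "sin (Im w) = 0"
    by (auto simp: complex_nonpos_Reals_iff Re_exp Im_exp)
  have "Im w = 0"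
    using *(2) assms sin_gt_zero[of "Im w"] sin_gt_zero[of "- Im w"] by (smt (verit) sin_minus)
  with * show False using exp_gt_zero[of "Re w"] by simp
qed

text \<open>
  In the variable \<open>z = log s\<close> the cut plane is the strip \<open>\<bar>Im z\<bar> < \<pi>\<close>, and the integrand extends
  analytically beyond the edges of the strip because \<open>\<beta> < 1\<close>.
\<close>

lemma exp_powr_contour_integral:
  fixes \<beta> \<nu> s R :: real
  assumes "0 < \<beta>" "\<beta> < 1" "0 < s" "\<bar>ln s\<bar> < R"
  defines "G \<equiv> \<lambda>z. (1 + exp (of_real \<beta> * z)) powr (- of_real \<nu>) * exp z / (exp z - of_real s)"
  shows "contour_integral (rectpath (Complex (- R) (- pi)) (Complex R pi)) G =
      2 * pi * \<i> * of_real ((1 + s powr \<beta>) powr (- \<nu>))" (is ?integral)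
    and "\<exists>U. open U \<and> G holomorphic_on U \<and>
      path_image (rectpath (Complex (- R) (- pi)) (Complex R pi)) \<subseteq> U" (is ?holo)
proof -
  \<comment> \<open>The strip of half width \<open>L\<close> contains the closed rectangle in its
    interior. The bound \<open>pi / \<beta>\<close>, which exceeds \<open>pi\<close> because
    \<open>\<beta> < 1\<close>, keeps the power analytic; the bound \<open>2 * pi\<close> excludes
    all zeros of \<open>exp z - s\<close> except \<open>ln s\<close>.\<close>
  define L where "L = min (pi / \<beta>) (2 * pi)"
  define S where "S = {z. Im z < L} \<inter> {z. - L < Im z}"
  have L: "pi < L" using assms by (auto simp: L_def field_simps)
  then have "0 < L" using pi_gt_zero by linarith
  have S: "open S" "convex S"
    by (auto simp: S_def open_halfspace_Im_lt open_halfspace_Im_gt convex_halfspace_Im_lt convex_halfspace_Im_gt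
      intro!: convex_Int)
  have Sd: "\<bar>Im z\<bar> < L" if "z \<in> S" for z using that by (auto simp: S_def)
  have hF: "(\<lambda>z. (1 + exp (of_real \<beta> * z)) powr (- of_real \<nu>) * exp z) holomorphic_on S"
  proof (intro holomorphic_intros)
    fix z assume "z \<in> S"
    then have "\<bar>Im z\<bar> < pi / \<beta>" using Sd[of z] by (auto simp: L_def)
    then have "\<bar>\<beta> * Im z\<bar> < pi" using assms by (auto simp: field_simps abs_mult)
    then show "1 + exp (of_real \<beta> * z) \<notin> \<real>\<^sub>\<le>\<^sub>0" by (intro one_plus_exp_not_nonpos) simp
  qed
  have hE: "(\<lambda>z. exp z - of_real s) holomorphic_on S" by (intro holomorphic_intros)
  let ?w = "complex_of_real (ln s)"
  have s0: "s \<noteq> 0" using assms(3) by simp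
  have ew: "exp ?w = of_real s" using assms(3) by (subst exp_of_real) simp
  have ne: "exp z - of_real s \<noteq> 0" if z: "z \<in> S - {?w}" for z
  proof
    assume "exp z - of_real s = 0"
    then have "exp z = exp ?w" by (simp add: ew)
    then obtain n :: int where n: "z = ?w + (of_int (2 * n) * pi) * \<i>" by (auto simp: exp_eq)
    then have "Im z = 2 * n * pi" by simp
    then have "\<bar>2 * n * pi\<bar> < 2 * pi" using Sd[of z] z by (auto simp: L_def)
    then have "\<bar>real_of_int n\<bar> < 1" by (simp add: abs_mult)
    then have "n = 0" by linarith
    with n z show False by simp
  qed
  have hG: "G holomorphic_on S - {?w}"
    unfolding G_def using hF hE ne
    by (intro holomorphic_on_divide) (auto intro: holomorphic_on_subset)
  have wS: "?w \<in> S" using \<open>0 < L\<close> by (auto simp: S_def)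
  have wb: "?w \<in> box (Complex (- R) (- pi)) (Complex R pi)"
    using assms by (auto simp: in_box_complex_iff)
  have cb: "cbox (Complex (- R) (- pi)) (Complex R pi) \<subseteq> S"
    using L by (auto simp: S_def in_cbox_complex_iff)
  have R: "0 < R" using assms by linarith
  have pin: "path_image (rectpath (Complex (- R) (- pi)) (Complex R pi)) \<subseteq> S - {?w}"
    using cb wb path_image_rectpath_cbox_minus_box[of "Complex (- R) (- pi)" "Complex R pi"] R by auto
  show ?holo using hG pin S by (intro exI[of _ "S - {?w}"]) auto
  \<comment> \<open>The denominator has derivative \<open>exp z\<close>, which equals
    \<open>s\<close> and is nonzero at \<open>ln s\<close>. So the pole is simple, and the factor
    \<open>exp z\<close> of the numerator cancels this derivative.\<close>
  have "residue G ?w = ((1 + exp (of_real \<beta> * ?w)) powr (- of_real \<nu>) * exp ?w) / exp ?w"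
    unfolding G_def
    by (rule residue_simple_pole_deriv[OF hF hE S(1) convex_connected[OF S(2)] wS])
      (use one_plus_exp_not_nonpos[of "of_real \<beta> * ?w"] in \<open>auto intro!: derivative_eq_intros simp: ew s0\<close>)
  also have "\<dots> = (1 + exp (of_real \<beta> * ?w)) powr (- of_real \<nu>)"
    by simp
  also have "exp (of_real \<beta> * ?w) = of_real (s powr \<beta>)"
    using assms by (simp add: powr_def mult.commute exp_of_real flip: of_real_mult)
  also have "(1 + of_real (s powr \<beta>)) powr (- of_real \<nu>) = complex_of_real ((1 + s powr \<beta>) powr (- \<nu>))"
    using powr_of_real[of "1 + s powr \<beta>" "- \<nu>"] by simp
  finally have res: "residue G ?w = of_real ((1 + s powr \<beta>) powr (- \<nu>))" .
  have "contour_integral (rectpath (Complex (- R) (- pi)) (Complex R pi)) G =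
      2 * pi * \<i> * (\<Sum>p\<in>{?w}. winding_number (rectpath (Complex (- R) (- pi)) (Complex R pi)) p * residue G p)"
  proof (rule Residue_theorem[OF S(1) convex_connected[OF S(2)] _ hG _ _ pin])
    show "\<forall>z. z \<notin> S \<longrightarrow> winding_number (rectpath (Complex (- R) (- pi)) (Complex R pi)) z = 0"
      using cb R by (auto intro!: winding_number_rectpath_outside)
  qed auto
  then show ?integral
    by (simp add: winding_number_rectpath[OF wb] res)
qed

text \<open>Each half line has a majorant from \<open>exp_Gamma_integral\<close>. For
  \<open>u \<le> 0\<close> the factor \<open>exp (- exp u)\<close> is at least
  \<open>exp (- 1)\<close>, so inserting it costs at most the constant \<open>exp 1\<close>; the
  reflected integrand serves for \<open>u \<ge> 0\<close>.\<close>

lemma integrable_exp_decay_both: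
  fixes f :: "real \<Rightarrow> real"
  assumes [measurable]: "f \<in> borel_measurable borel" and ab: "0 < a" "0 < b"
    and f: "\<And>u. \<bar>f u\<bar> \<le> A * exp (a * u)" "\<And>u. \<bar>f u\<bar> \<le> B * exp (- b * u)"
  shows "integrable lborel f"
proof -
  have AB: "0 \<le> A" "0 \<le> B" using f[of 0] by simp_all
  have 1: "integrable lborel (\<lambda>u. exp (a * u - 1 * exp u))"
    using exp_Gamma_integral[OF ab(1), of 1] by (simp add: has_bochner_integral_iff)
  have "integrable lborel (\<lambda>u. exp (b * u - 1 * exp u))"
    using exp_Gamma_integral[OF ab(2), of 1] by (simp add: has_bochner_integral_iff)
  from lborel_integrable_real_affine[OF this, of "-1" 0]
  have 2: "integrable lborel (\<lambda>u. exp (- b * u - exp (- u)))" by simp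
  have "integrable lborel (\<lambda>u. exp 1 * A * exp (a * u - 1 * exp u) + exp 1 * B * exp (- b * u - exp (- u)))"
    using 1 2 by (intro Bochner_Integration.integrable_add integrable_mult_right)
  then show ?thesis
  proof (rule Bochner_Integration.integrable_bound)
    show "AE u in lborel. norm (f u) \<le> norm (exp 1 * A * exp (a * u - 1 * exp u) + exp 1 * B * exp (- b * u - exp (- u)))"
    proof (rule AE_I2)
      fix u :: real
      have e: "A * exp (a * u) \<le> exp 1 * A * exp (a * u - 1 * exp u)" if "u \<le> 0"
      proof -
        have "A * exp (a * u) * 1 \<le> A * exp (a * u) * exp (1 - exp u)"
          using AB that by (intro mult_left_mono) auto
        also have "\<dots> = exp 1 * A * exp (a * u - 1 * exp u)" by (simp add: exp_diff)
        finally show ?thesis by simp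
      qed
      have e': "B * exp (- b * u) \<le> exp 1 * B * exp (- b * u - exp (- u))" if "0 \<le> u"
      proof -
        have "B * exp (- b * u) * 1 \<le> B * exp (- b * u) * exp (1 - exp (- u))"
          using AB that by (intro mult_left_mono) auto
        also have "\<dots> = exp 1 * B * exp (- b * u - exp (- u))" by (simp add: exp_diff)
        finally show ?thesis by simp
      qed
      have p: "0 \<le> exp 1 * A * exp (a * u - 1 * exp u)" "0 \<le> exp 1 * B * exp (- b * u - exp (- u))"
        using AB by auto
      have "\<bar>f u\<bar> \<le> exp 1 * A * exp (a * u - 1 * exp u) + exp 1 * B * exp (- b * u - exp (- u))"
        using e e' p f[of u] by (cases "u \<le> 0") linarith+
      then show "norm (f u) \<le> norm (exp 1 * A * exp (a * u - 1 * exp u) + exp 1 * B * exp (- b * u - exp (- u)))"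
        unfolding real_norm_def by linarith
    qed
  qed measurable
qed

text \<open>The density \<open>\<rho>(exp u)\<close>, the value below the cut minus the value above it, divided by \<open>2 \<pi> i\<close>.\<close>

definition stieltjes_weight :: "real \<Rightarrow> real \<Rightarrow> real \<Rightarrow> real" where
  "stieltjes_weight \<beta> \<nu> u = - Im ((1 + of_real (exp (\<beta> * u)) * cis (pi * \<beta>)) powr (- of_real \<nu>)) / pi"

text \<open>This is \<open>Im_powr_binomial_remainder\<close> at
  \<open>x = exp (\<beta> * u)\<close> and angle \<open>pi * \<beta>\<close>, divided by
  \<open>- pi\<close>. The bound holds for all \<open>u\<close>, so that it can be integrated over
  the whole line. The term \<open>j = 0\<close> is zero because of its sine.\<close>

lemma stieltjes_weight_expansion:
  assumes "0 < \<beta>" "\<beta> < 1" "0 < \<nu>" "0 < N"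
  shows "\<bar>stieltjes_weight \<beta> \<nu> u -
      (\<Sum>j<N. - ((- 1) ^ j) * pochhammer \<nu> j / fact j * sin (pi * \<beta> * j) / pi * exp (\<beta> * j * u))\<bar>
    \<le> pochhammer \<nu> N / fact N * sin (pi * \<beta>) powr (- (\<nu> + N)) / pi * exp (\<beta> * N * u)"
proof -
  have ex: "exp (\<beta> * u) ^ j = exp (\<beta> * j * u)" for j
    by (simp add: exp_of_nat_mult[symmetric] mult_ac)
  have "\<bar>Im ((1 + of_real (exp (\<beta> * u)) * cis (pi * \<beta>)) powr (- complex_of_real \<nu>)) -
           (\<Sum>j<N. (- 1) ^ j * pochhammer \<nu> j / fact j * exp (\<beta> * u) ^ j * sin (j * (pi * \<beta>)))\<bar>
         \<le> pochhammer \<nu> N / fact N * \<bar>exp (\<beta> * u)\<bar> ^ N * sin (pi * \<beta>) powr (- (\<nu> + N))" (is "?l \<le> ?r")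
    using assms by (intro Im_powr_binomial_remainder) auto
  then have "?l / pi \<le> ?r / pi" by (rule divide_right_mono) simp
  moreover have "?l / pi = \<bar>stieltjes_weight \<beta> \<nu> u -
      (\<Sum>j<N. - ((- 1) ^ j) * pochhammer \<nu> j / fact j * sin (pi * \<beta> * j) / pi * exp (\<beta> * j * u))\<bar>"
  proof -
    have "?l / pi = \<bar>(Im ((1 + of_real (exp (\<beta> * u)) * cis (pi * \<beta>)) powr (- complex_of_real \<nu>)) -
           (\<Sum>j<N. (- 1) ^ j * pochhammer \<nu> j / fact j * exp (\<beta> * u) ^ j * sin (j * (pi * \<beta>)))) / (- pi)\<bar>"
      by (simp only: abs_divide) simp
    also have "\<dots> = \<bar>stieltjes_weight \<beta> \<nu> u -
      (\<Sum>j<N. (- 1) ^ j * pochhammer \<nu> j / fact j * exp (\<beta> * u) ^ j * sin (j * (pi * \<beta>))) / (- pi)\<bar>"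
      unfolding diff_divide_distrib by (simp add: stieltjes_weight_def)
    also have "(\<Sum>j<N. (- 1) ^ j * pochhammer \<nu> j / fact j * exp (\<beta> * u) ^ j * sin (j * (pi * \<beta>))) / (- pi) =
      (\<Sum>j<N. - ((- 1) ^ j) * pochhammer \<nu> j / fact j * sin (pi * \<beta> * j) / pi * exp (\<beta> * j * u))"
      unfolding sum_divide_distrib ex by (rule sum.cong) (simp_all add: mult_ac)
    finally show ?thesis .
  qed
  ultimately show ?thesis by (simp add: ex mult_ac)
qed

lemma stieltjes_weight_measurable [measurable]:
  assumes "0 < \<beta>" "\<beta> < 1"
  shows "stieltjes_weight \<beta> \<nu> \<in> borel_measurable borel"
proof -
  have "0 < sin (pi * \<beta>)" using assms by (simp add: sin_gt_zero)
  then have "1 + of_real (exp (\<beta> * u)) * cis (pi * \<beta>) \<noteq> 0" for u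
    by (simp add: complex_eq_iff)
  with \<open>0 < sin (pi * \<beta>)\<close> show ?thesis
    unfolding stieltjes_weight_def[abs_def]
    by (intro borel_measurable_continuous_onI continuous_intros) auto
qed

text \<open>Towards minus infinity the expansion with \<open>N = 1\<close> gives decay like
  \<open>exp (\<beta> * u)\<close>, since its only term is zero. Towards plus infinity the modulus
  of the base is at least its imaginary part \<open>sin (pi * \<beta>) * exp (\<beta> * u)\<close>,
  which gives decay like \<open>exp (- \<beta> * \<nu> * u)\<close>.\<close>

lemma stieltjes_weight_integrable:
  assumes "0 < \<beta>" "\<beta> < 1" "0 < \<nu>"
  shows "integrable lborel (stieltjes_weight \<beta> \<nu>)"
proof (rule integrable_exp_decay_both)
  show "stieltjes_weight \<beta> \<nu> \<in> borel_measurable borel" using assms by simp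
  have s: "0 < sin (pi * \<beta>)" using assms by (simp add: sin_gt_zero)
  fix u
  show "\<bar>stieltjes_weight \<beta> \<nu> u\<bar> \<le> pochhammer \<nu> 1 / fact 1 * sin (pi * \<beta>) powr (- (\<nu> + 1)) / pi * exp (\<beta> * u)"
    using stieltjes_weight_expansion[OF assms, of 1 u] by simp
  let ?z = "1 + of_real (exp (\<beta> * u)) * cis (pi * \<beta>)"
  have "sin (pi * \<beta>) * exp (\<beta> * u) = Im ?z" by simp
  also have "\<dots> \<le> norm ?z" using abs_Im_le_cmod[of ?z] by linarith
  finally have z: "sin (pi * \<beta>) * exp (\<beta> * u) \<le> norm ?z" .
  have "\<bar>Im (?z powr (- of_real \<nu>))\<bar> \<le> norm (?z powr (- of_real \<nu>))" by (rule abs_Im_le_cmod)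
  also have "\<dots> = norm ?z powr (- \<nu>)" by (rule norm_powr_minus_of_real)
  also have "\<dots> \<le> (sin (pi * \<beta>) * exp (\<beta> * u)) powr (- \<nu>)"
    using s assms z by (intro powr_mono2') auto
  also have "\<dots> = sin (pi * \<beta>) powr (- \<nu>) * exp (- (\<beta> * \<nu>) * u)"
    using s by (simp add: powr_mult powr_def[of "exp _"] mult_ac)
  finally have "\<bar>Im (?z powr (- of_real \<nu>))\<bar> / pi \<le> sin (pi * \<beta>) powr (- \<nu>) * exp (- (\<beta> * \<nu>) * u) / pi"
    by (rule divide_right_mono) simp
  then show "\<bar>stieltjes_weight \<beta> \<nu> u\<bar> \<le> sin (pi * \<beta>) powr (- \<nu>) / pi * exp (- (\<beta> * \<nu>) * u)"
    by (simp add: stieltjes_weight_def)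
qed (use assms in auto)


section \<open>The limit of growing rectangles\<close>

lemma tendsto_integral_symmetric_interval:
  fixes f :: "real \<Rightarrow> real"
  assumes f: "integrable lborel f"
  shows "(\<lambda>n. integral {- real n..real n} f) \<longlonglongrightarrow> (LINT x|lborel. f x)"
proof -
  have [measurable]: "f \<in> borel_measurable lborel" using f by (rule borel_measurable_integrable)
  have "(\<lambda>n. LINT x|lborel. indicator {- real n..real n} x *\<^sub>R f x) \<longlonglongrightarrow> (LINT x|lborel. f x)"
  proof (rule integral_dominated_convergence[where w = "\<lambda>x. \<bar>f x\<bar>"])
    show "AE x in lborel. (\<lambda>n. indicator {- real n..real n} x *\<^sub>R f x) \<longlonglongrightarrow> f x"
    proof (rule AE_I2, rule tendsto_eventually)
      fix x :: real
      have "eventually (\<lambda>n. \<bar>x\<bar> \<le> real n) sequentially" by real_asymp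
      then show "eventually (\<lambda>n. indicator {- real n..real n} x *\<^sub>R f x = f x) sequentially"
        by eventually_elim (auto simp: indicator_def)
    qed
  qed (use f in \<open>auto simp: indicator_def\<close>)
  moreover have "(LINT x|lborel. indicator {- real n..real n} x *\<^sub>R f x) = integral {- real n..real n} f" for n
    using set_borel_integral_eq_integral(2)[of "{- real n..real n}" f] integrable_mult_indicator[OF _ f, of "{- real n..real n}"]
    by (simp add: set_integrable_def set_lebesgue_integral_def)
  ultimately show ?thesis by simp
qed

text \<open>The rectangle of half width \<open>R\<close> encloses the pole \<open>ln s\<close>. Its
  horizontal sides contribute the integral of the jump over the interval from \<open>- R\<close> to
  \<open>R\<close>, and its vertical sides vanish in the limit.\<close>

lemma stieltjes_representation:
  assumes \<beta>: "0 < \<beta>" "\<beta> < 1" and \<nu>: "0 < \<nu>" and s: "0 < s"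
  shows "(LINT u|lborel. stieltjes_weight \<beta> \<nu> u * (exp u / (exp u + s))) = (1 + s powr \<beta>) powr (- \<nu>)"
proof -
  define h where "h = (\<lambda>u. stieltjes_weight \<beta> \<nu> u * (exp u / (exp u + s)))"
  define G where "G = (\<lambda>z::complex. (1 + exp (of_real \<beta> * z)) powr (- of_real \<nu>) * exp z / (exp z - of_real s))"
  \<comment> \<open>A bound for \<open>G\<close> on the vertical line with real part
    \<open>x\<close>, obtained from the reverse triangle inequality in both factors. It tends to 0
    at both ends: like \<open>exp (- \<beta> * \<nu> * R)\<close> on the right and like
    \<open>exp (- R) / s\<close> on the left.\<close>
  define B where "B = (\<lambda>x. \<bar>exp (\<beta> * x) - 1\<bar> powr (- \<nu>) * exp x / \<bar>exp x - s\<bar>)"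
  let ?\<phi> = "(1 + s powr \<beta>) powr (- \<nu>)"
  have sin: "0 < sin (pi * \<beta>)" using \<beta> by (simp add: sin_gt_zero)
  have h: "integrable lborel h"
  proof (rule Bochner_Integration.integrable_bound[OF stieltjes_weight_integrable[OF \<beta> \<nu>]])
    show "h \<in> borel_measurable lborel" unfolding h_def using \<beta> by measurable
    show "AE u in lborel. norm (h u) \<le> norm (stieltjes_weight \<beta> \<nu> u)"
    proof (rule AE_I2)
      fix u :: real
      have "exp u / (exp u + s) \<le> 1" "0 \<le> exp u / (exp u + s)"
        using s by (auto simp: divide_le_eq add_pos_pos)
      then have "\<bar>exp u / (exp u + s)\<bar> \<le> 1" by (simp only: abs_of_nonneg)
      then have "\<bar>stieltjes_weight \<beta> \<nu> u\<bar> * \<bar>exp u / (exp u + s)\<bar> \<le> \<bar>stieltjes_weight \<beta> \<nu> u\<bar> * 1"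
        by (rule mult_left_mono) simp
      then show "norm (h u) \<le> norm (stieltjes_weight \<beta> \<nu> u)"
        by (simp only: h_def abs_mult real_norm_def mult_1_right)
    qed
  qed
  \<comment> \<open>On both edges \<open>exp z\<close> equals \<open>- exp x\<close>, while the
    values of \<open>exp (\<beta> * z)\<close> are complex conjugates of each other. Hence the
    difference is that of a number and its conjugate, which isolates the imaginary part.\<close>
  have jump: "G (Complex x (- pi)) - G (Complex x pi) = 2 * pi * \<i> * of_real (h x)" for x
  proof -
    let ?c = "1 + of_real (exp (\<beta> * x)) * cis (pi * \<beta>)"
    have ee: "exp (Complex x pi) = - of_real (exp x)" "exp (Complex x (- pi)) = - of_real (exp x)"
      by (simp_all add: exp_eq_polar complex_eq_iff)
    have b: "exp (of_real \<beta> * Complex x pi) = of_real (exp (\<beta> * x)) * cis (pi * \<beta>)"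
      "exp (of_real \<beta> * Complex x (- pi)) = cnj (of_real (exp (\<beta> * x)) * cis (pi * \<beta>))"
      by (simp_all add: exp_eq_polar complex_eq_iff mult_ac)
    have k: "- of_real (exp x) / (- of_real (exp x) - of_real s) = complex_of_real (exp x / (exp x + s))"
    proof -
      have "- of_real (exp x) / (- of_real (exp x) - of_real s) = - complex_of_real (exp x) / - (of_real (exp x) + of_real s)"
        by simp
      also have "\<dots> = complex_of_real (exp x / (exp x + s))" by (simp only: minus_divide_divide of_real_divide of_real_add)
      finally show ?thesis .
    qed
    have cn: "(1 + cnj (of_real (exp (\<beta> * x)) * cis (pi * \<beta>))) powr (- of_real \<nu>) = cnj (?c powr (- of_real \<nu>))"
      using sin by (subst cnj_powr) auto
    have "G (Complex x (- pi)) - G (Complex x pi) =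
        (cnj (?c powr (- of_real \<nu>)) - ?c powr (- of_real \<nu>)) * (- of_real (exp x) / (- of_real (exp x) - of_real s))"
      unfolding G_def ee b cn by (simp only: left_diff_distrib times_divide_eq_right diff_divide_distrib)
    also have "cnj (?c powr (- of_real \<nu>)) - ?c powr (- of_real \<nu>) = 2 * pi * \<i> * of_real (stieltjes_weight \<beta> \<nu> x)"
      by (simp add: complex_eq_iff stieltjes_weight_def)
    finally show ?thesis unfolding k by (simp add: h_def mult.assoc)
  qed
  have GB: "norm (G z) \<le> B (Re z)" if "Re z \<noteq> 0" "exp (Re z) \<noteq> s" for z
  proof -
    have 1: "\<bar>exp (\<beta> * Re z) - 1\<bar> \<le> norm (1 + exp (of_real \<beta> * z))"
      using norm_triangle_ineq3[of "exp (of_real \<beta> * z)" "-1"] by (simp add: norm_exp_eq_Re add.commute)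
    have 2: "\<bar>exp (Re z) - s\<bar> \<le> norm (exp z - of_real s)"
      using norm_triangle_ineq3[of "exp z" "of_real s"] s by (simp add: norm_exp_eq_Re)
    have 3: "0 < \<bar>exp (\<beta> * Re z) - 1\<bar>" "0 < \<bar>exp (Re z) - s\<bar>" using that \<beta> by auto
    have "norm (G z) = norm (1 + exp (of_real \<beta> * z)) powr (- \<nu>) * exp (Re z) / norm (exp z - of_real s)"
      unfolding G_def norm_mult norm_divide norm_powr_minus_of_real norm_exp_eq_Re by simp
    also have "\<dots> \<le> B (Re z)"
      unfolding B_def using 1 2 3 \<nu> by (intro frac_le mult_right_mono powr_mono2') auto
    finally show ?thesis .
  qed
  \<comment> \<open>The residue theorem leaves the two vertical sides as the only error; each has
    length \<open>2 * pi\<close>.\<close>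
  have est: "norm (2 * pi * \<i> * of_real ?\<phi> - 2 * pi * \<i> * of_real (integral {- R..R} h)) \<le> (B R + B (- R)) * (2 * pi)"
    if R: "\<bar>ln s\<bar> < R" for R
  proof -
    let ?a = "Complex (- R) (- pi)" and ?b = "Complex R pi"
    note c = exp_powr_contour_integral[OF \<beta> s R, of \<nu>, folded G_def]
    obtain U where U: "open U" "G holomorphic_on U" "path_image (rectpath ?a ?b) \<subseteq> U"
      using c(2) by blast
    have R0: "0 < R" using R by linarith
    have Rs: "exp R \<noteq> s" "exp (- R) \<noteq> s" using R s by (auto simp: abs_less_iff)
    have sub: "closed_segment ?a (Complex R (- pi)) \<subseteq> U" "closed_segment (Complex R (- pi)) ?b \<subseteq> U"
      "closed_segment ?b (Complex (- R) pi) \<subseteq> U" "closed_segment (Complex (- R) pi) ?a \<subseteq> U"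
      using U by (auto simp: rectpath_def Let_def path_image_join)
    note ci = contour_integrable_holomorphic_simple[OF U(2) U(1) valid_path_linepath, unfolded path_image_linepath]
    have V1: "norm (contour_integral (linepath (Complex R (- pi)) ?b) G) \<le> B R * norm (?b - Complex R (- pi))"
      using R0 Rs by (intro contour_integral_bound_linepath ci sub)
        (auto simp: B_def closed_segment_same_Re intro: order_trans[OF GB])
    have V2: "norm (contour_integral (linepath (Complex (- R) pi) ?a) G) \<le> B (- R) * norm (?a - Complex (- R) pi)"
      using R0 Rs by (intro contour_integral_bound_linepath ci sub)
        (auto simp: B_def closed_segment_same_Re intro: order_trans[OF GB])
    have n: "norm (?b - Complex R (- pi)) = 2 * pi" "norm (?a - Complex (- R) pi) = 2 * pi"
      by (simp_all add: cmod_def real_sqrt_mult)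
    have cont: "(\<lambda>x. G (Complex x (- pi))) integrable_on {- R..R}" "(\<lambda>x. G (Complex x pi)) integrable_on {- R..R}"
    proof -
      have *: "(\<lambda>x. Complex x (- pi)) ` {- R..R} \<subseteq> U" "(\<lambda>x. Complex x pi) ` {- R..R} \<subseteq> U"
        using sub(1,3) R0 by (auto simp: closed_segment_same_Im closed_segment_eq_real_ivl)
      show "(\<lambda>x. G (Complex x (- pi))) integrable_on {- R..R}" "(\<lambda>x. G (Complex x pi)) integrable_on {- R..R}"
        by (rule integrable_continuous_real,
            rule continuous_on_compose2[OF holomorphic_on_imp_continuous_on[OF U(2)] _ *(1)]
              continuous_on_compose2[OF holomorphic_on_imp_continuous_on[OF U(2)] _ *(2)],
            simp add: Complex_eq continuous_intros)+
    qed
    have "2 * pi * \<i> * of_real ?\<phi> = integral {- R..R} (\<lambda>x. G (Complex x (- pi))) - integral {- R..R} (\<lambda>x. G (Complex x pi))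
      + contour_integral (linepath (Complex R (- pi)) ?b) G + contour_integral (linepath (Complex (- R) pi) ?a) G"
      using contour_integral_rectpath[OF U(2,1) _ _ U(3)] c(1) R0 by simp
    also have "integral {- R..R} (\<lambda>x. G (Complex x (- pi))) - integral {- R..R} (\<lambda>x. G (Complex x pi)) =
      integral {- R..R} (\<lambda>x. 2 * pi * \<i> * of_real (h x))"
      unfolding jump[symmetric] by (rule Henstock_Kurzweil_Integration.integral_diff[symmetric, OF cont])
    also have "\<dots> = 2 * pi * \<i> * of_real (integral {- R..R} h)"
    proof -
      have "h integrable_on {- R..R}"
        using set_borel_integral_eq_integral(1)[of "{- R..R}" h] integrable_mult_indicator[OF _ h, of "{- R..R}"]
        by (simp add: set_integrable_def)
      then have "integral {- R..R} (\<lambda>x. complex_of_real (h x)) = of_real (integral {- R..R} h)"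
        by (intro integral_unique has_integral_of_real integrable_integral)
      then show ?thesis by simp
    qed
    finally have "norm (2 * pi * \<i> * of_real ?\<phi> - 2 * pi * \<i> * of_real (integral {- R..R} h)) =
        norm (contour_integral (linepath (Complex R (- pi)) ?b) G + contour_integral (linepath (Complex (- R) pi) ?a) G)"
      by simp
    also have "\<dots> \<le> (B R + B (- R)) * (2 * pi)"
      using V1 V2 unfolding n by (intro order_trans[OF norm_triangle_ineq]) (simp add: algebra_simps)
    finally show ?thesis .
  qed
  \<comment> \<open>The limits are computed with the absolute values in \<open>B\<close> resolved;
    the signs used are correct as soon as \<open>R\<close> exceeds the absolute value of
    \<open>ln s\<close>.\<close>
  have "((\<lambda>R. (exp (\<beta> * R) - 1) powr (- \<nu>) * exp R / (exp R - s)) \<longlongrightarrow> 0) at_top"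
    using \<beta>(1) \<nu> by real_asymp
  moreover have "((\<lambda>R. (1 - exp (- \<beta> * R)) powr (- \<nu>) * exp (- R) / (s - exp (- R))) \<longlongrightarrow> 0) at_top"
    using \<beta>(1) \<nu> s by real_asymp
  ultimately have "((\<lambda>R. (exp (\<beta> * R) - 1) powr (- \<nu>) * exp R / (exp R - s) +
      (1 - exp (- \<beta> * R)) powr (- \<nu>) * exp (- R) / (s - exp (- R))) \<longlongrightarrow> 0) at_top"
    by (rule tendsto_add_zero)
  moreover have "eventually (\<lambda>R. (exp (\<beta> * R) - 1) powr (- \<nu>) * exp R / (exp R - s) +
      (1 - exp (- \<beta> * R)) powr (- \<nu>) * exp (- R) / (s - exp (- R)) = B R + B (- R)) at_top"
    using eventually_gt_at_top[of "\<bar>ln s\<bar>"]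
  proof eventually_elim
    fix R assume R: "\<bar>ln s\<bar> < R"
    then have "exp (ln s) < exp R" "exp (- R) < exp (ln s)" by (auto simp only: exp_less_cancel_iff abs_less_iff)
    then have "s < exp R" "exp (- R) < s" using s by simp_all
    moreover have "0 < \<beta> * R" using R \<beta> by (intro mult_pos_pos) linarith+
    ultimately show "(exp (\<beta> * R) - 1) powr (- \<nu>) * exp R / (exp R - s) +
      (1 - exp (- \<beta> * R)) powr (- \<nu>) * exp (- R) / (s - exp (- R)) = B R + B (- R)"
      by (simp add: B_def abs_if)
  qed
  ultimately have "((\<lambda>R. B R + B (- R)) \<longlongrightarrow> 0) at_top"
    by (rule Lim_transform_eventually)
  then have "((\<lambda>R. (B R + B (- R)) * (2 * pi)) \<longlongrightarrow> 0) at_top"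
    by (rule tendsto_mult_left_zero)
  then have Blim: "(\<lambda>n. (B (real n) + B (- real n)) * (2 * pi)) \<longlonglongrightarrow> 0"
    by (rule filterlim_compose[OF _ filterlim_real_sequentially])
  have "(\<lambda>n. 2 * pi * \<i> * of_real ?\<phi> - 2 * pi * \<i> * of_real (integral {- real n..real n} h)) \<longlonglongrightarrow> 0"
  proof (rule Lim_null_comparison[OF _ Blim])
    have "eventually (\<lambda>n. \<bar>ln s\<bar> < real n) sequentially" by real_asymp
    then show "\<forall>\<^sub>F n in sequentially. norm (2 * pi * \<i> * of_real ?\<phi> - 2 * pi * \<i> * of_real (integral {- real n..real n} h))
        \<le> (B (real n) + B (- real n)) * (2 * pi)"
      by eventually_elim (rule est)
  qed
  moreover have "(\<lambda>n. 2 * pi * \<i> * of_real ?\<phi> - 2 * pi * \<i> * of_real (integral {- real n..real n} h))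
      \<longlonglongrightarrow> 2 * pi * \<i> * of_real ?\<phi> - 2 * pi * \<i> * of_real (LINT x|lborel. h x)"
    by (intro tendsto_intros tendsto_integral_symmetric_interval h)
  ultimately have "2 * pi * \<i> * of_real ?\<phi> - 2 * pi * \<i> * of_real (LINT x|lborel. h x) = 0"
    by (rule LIMSEQ_unique[symmetric])
  then have "complex_of_real ?\<phi> = of_real (LINT x|lborel. h x)"
    by simp
  then show ?thesis unfolding h_def of_real_eq_iff by simp
qed

subsection \<open>Heat kernel and Fourier inversion\<close>

text \<open>The characteristic function of the standard normal law after the scaling
  \<open>y = a * t\<close> with \<open>a = sqrt (2 * \<epsilon>)\<close>, chosen so that
  \<open>y\<^sup>2 / 2\<close> becomes \<open>\<epsilon> * t\<^sup>2\<close>.\<close>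

lemma gaussian_fourier_real:
  fixes x \<epsilon> :: real
  assumes "0 < \<epsilon>"
  shows "has_bochner_integral lborel (\<lambda>t. of_real (exp (- \<epsilon> * t\<^sup>2)) * iexp (x * t))
    (complex_of_real (sqrt (pi / \<epsilon>) * exp (- x\<^sup>2 / (4 * \<epsilon>))))"
proof -
  define a where "a = sqrt (2 * \<epsilon>)"
  have a: "0 < a" "a\<^sup>2 = 2 * \<epsilon>" using assms by (auto simp: a_def)
  have int: "integrable lborel (\<lambda>y. std_normal_density y *\<^sub>R iexp (s * y))" for s
  proof (rule Bochner_Integration.integrable_bound)
    show "integrable lborel std_normal_density" by simp
  qed auto
  have "(LINT y|lborel. std_normal_density y *\<^sub>R iexp (s * y)) = of_real (exp (- s\<^sup>2 / 2))" for s
    using fun_cong[OF char_std_normal_distribution, of s]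
    by (simp add: char_def integral_density)
  with int have "has_bochner_integral lborel (\<lambda>y. std_normal_density y *\<^sub>R iexp (s * y)) (of_real (exp (- s\<^sup>2 / 2)))" for s
    by (simp add: has_bochner_integral_iff)
  from this[of "x / a"] have "has_bochner_integral lborel
     (\<lambda>t. std_normal_density (0 + a * t) *\<^sub>R iexp (x / a * (0 + a * t))) (of_real (exp (- (x / a)\<^sup>2 / 2)) /\<^sub>R \<bar>a\<bar>)"
    using a by (subst (asm) lborel_has_bochner_integral_real_affine_iff[of a _ _ 0]) auto
  then have "has_bochner_integral lborel (\<lambda>t. of_real (sqrt (2 * pi)) *
     (std_normal_density (0 + a * t) *\<^sub>R iexp (x / a * (0 + a * t))))
     (of_real (sqrt (2 * pi)) * (of_real (exp (- (x / a)\<^sup>2 / 2)) /\<^sub>R \<bar>a\<bar>))"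
    by (rule has_bochner_integral_mult_right)
  moreover have "of_real (sqrt (2 * pi)) * (std_normal_density (0 + a * t) *\<^sub>R iexp (x / a * (0 + a * t))) =
      of_real (exp (- \<epsilon> * t\<^sup>2)) * iexp (x * t)" for t
    using a by (simp add: std_normal_density_def scaleR_conv_of_real power_mult_distrib)
  moreover have "of_real (sqrt (2 * pi)) * (of_real (exp (- (x / a)\<^sup>2 / 2)) /\<^sub>R \<bar>a\<bar>) =
     complex_of_real (sqrt (pi / \<epsilon>) * exp (- x\<^sup>2 / (4 * \<epsilon>)))"
  proof -
    have "sqrt (2 * pi) / a = sqrt (pi / \<epsilon>)"
      unfolding a_def real_sqrt_divide[symmetric] using assms by simp
    moreover have "(x / a)\<^sup>2 / 2 = x\<^sup>2 / (4 * \<epsilon>)"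
      using a by (simp add: power_divide)
    ultimately have "sqrt (2 * pi) * exp (- (x / a)\<^sup>2 / 2) / a = sqrt (pi / \<epsilon>) * exp (- x\<^sup>2 / (4 * \<epsilon>))"
      by (metis minus_divide_left times_divide_eq_left)
    then show ?thesis
      using a by (simp add: scaleR_conv_of_real field_simps flip: of_real_mult of_real_divide of_real_inverse)
  qed
  ultimately show ?thesis by simp
qed

text \<open>\<open>lborel\<close> is the image of the product of its one-dimensional versions under
  the map from coordinates to vectors, so Fubini's theorem for products applies. It reduces
  Gaussians in any dimension to the real line.\<close>

lemma has_bochner_integral_lborel_prod:
  fixes f :: "'a::euclidean_space \<Rightarrow> real \<Rightarrow> 'b::{real_normed_field,banach,second_countable_topology}"
  assumes f: "\<And>b. b \<in> Basis \<Longrightarrow> has_bochner_integral lborel (f b) (c b)"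
  shows "has_bochner_integral lborel (\<lambda>x::'a. \<Prod>b\<in>Basis. f b (x \<bullet> b)) (\<Prod>b\<in>Basis. c b)"
proof -
  interpret product_sigma_finite "\<lambda>_::'a. lborel :: real measure" ..
  have i: "\<And>b. b \<in> Basis \<Longrightarrow> integrable lborel (f b)" "\<And>b. b \<in> Basis \<Longrightarrow> integral\<^sup>L lborel (f b) = c b"
    using f by (auto simp: has_bochner_integral_iff)
  have m: "\<And>b. b \<in> Basis \<Longrightarrow> f b \<in> borel_measurable borel"
    using borel_measurable_integrable[OF i(1)] by simp
  have "has_bochner_integral (\<Pi>\<^sub>M b\<in>Basis. lborel) (\<lambda>x::'a \<Rightarrow> real. \<Prod>b\<in>Basis. f b (x b)) (\<Prod>b\<in>Basis. c b)"
    using product_integrable_prod[of Basis f] product_integral_prod[of Basis f] i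
    by (simp add: has_bochner_integral_iff)
  then have "has_bochner_integral (\<Pi>\<^sub>M b\<in>Basis. lborel)
      (\<lambda>x::'a \<Rightarrow> real. \<Prod>b\<in>Basis. f b ((\<Sum>b\<in>Basis. x b *\<^sub>R b) \<bullet> b)) (\<Prod>b\<in>Basis. c b)"
    by (simp cong: prod.cong)
  then have "has_bochner_integral (distr (\<Pi>\<^sub>M b\<in>Basis. lborel) borel (\<lambda>f. \<Sum>b\<in>Basis. f b *\<^sub>R b))
     (\<lambda>x::'a. \<Prod>b\<in>Basis. f b (x \<bullet> b)) (\<Prod>b\<in>Basis. c b)"
    using m by (intro has_bochner_integral_distr) (auto intro!: borel_measurable_prod measurable_compose[OF _ m])
  then show ?thesis by (simp add: lborel_eq[where 'a='a])
qed

lemma gaussian_fourier: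
  fixes x :: "'a::euclidean_space" and \<epsilon> :: real
  assumes "0 < \<epsilon>"
  shows "has_bochner_integral lborel (\<lambda>t. of_real (exp (- \<epsilon> * (norm t)\<^sup>2)) * iexp (x \<bullet> t))
    (complex_of_real ((pi / \<epsilon>) powr (real DIM('a) / 2) * exp (- (norm x)\<^sup>2 / (4 * \<epsilon>))))"
proof -
  have n: "(norm t)\<^sup>2 = (\<Sum>b\<in>Basis. (t \<bullet> b)\<^sup>2)" for t :: 'a
    by (simp add: norm_eq_sqrt_inner euclidean_inner[of t t] power2_eq_square sum_nonneg)
  have "(\<Prod>b\<in>Basis. of_real (exp (- \<epsilon> * (t \<bullet> b)\<^sup>2)) * iexp ((x \<bullet> b) * (t \<bullet> b))) =
      of_real (exp (- \<epsilon> * (norm t)\<^sup>2)) * iexp (x \<bullet> t)" for t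
    by (simp add: n euclidean_inner[of x t] prod.distrib sum_distrib_left exp_sum flip: of_real_prod sum_negf)
  moreover have "(\<Prod>b\<in>(Basis::'a set). complex_of_real (sqrt (pi / \<epsilon>) * exp (- (x \<bullet> b)\<^sup>2 / (4 * \<epsilon>)))) =
      of_real ((pi / \<epsilon>) powr (real DIM('a) / 2) * exp (- (norm x)\<^sup>2 / (4 * \<epsilon>)))"
  proof -
    have "sqrt (pi / \<epsilon>) ^ DIM('a) = (pi / \<epsilon>) powr (real DIM('a) / 2)"
      using assms by (simp add: powr_half_sqrt[symmetric] powr_powr flip: powr_realpow)
    moreover have "(\<Prod>b\<in>(Basis::'a set). exp (- (x \<bullet> b)\<^sup>2 / (4 * \<epsilon>))) = exp (- (norm x)\<^sup>2 / (4 * \<epsilon>))"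
      by (simp add: n sum_divide_distrib flip: exp_sum sum_negf)
    ultimately show ?thesis
      unfolding of_real_prod[symmetric] prod.distrib by (simp only: prod_constant)
  qed
  ultimately show ?thesis
    using has_bochner_integral_lborel_prod[OF gaussian_fourier_real[OF assms],
        of "\<lambda>b. x \<bullet> b"] by simp
qed

text \<open>The time is normalized for the heat equation with the full Laplacian: for
  \<open>\<tau> > 0\<close> each coordinate is normal with variance \<open>2 * \<tau>\<close>, so
  that the Fourier transform is \<open>exp (- \<tau> * (norm t)\<^sup>2)\<close>.\<close>

definition heat_kernel :: "real \<Rightarrow> 'a::euclidean_space \<Rightarrow> real" where
  "heat_kernel \<tau> x = (4 * pi * \<tau>) powr (- (real DIM('a) / 2)) * exp (- (norm x)\<^sup>2 / (4 * \<tau>))"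

lemma heat_kernel_nonneg: "0 \<le> heat_kernel \<tau> x"
  by (simp add: heat_kernel_def)

lemma heat_kernel_measurable [measurable]:
  assumes [measurable]: "f \<in> borel_measurable M" "g \<in> borel_measurable M"
  shows "(\<lambda>x. heat_kernel (f x) (g x)) \<in> borel_measurable M"
  unfolding heat_kernel_def by measurable

text \<open>Fourier inversion for the Gaussian itself, which follows from the explicit transform.
  Inversion for a general density is reduced to this case by Fubini's theorem.\<close>

lemma heat_kernel_fourier:
  fixes x :: "'a::euclidean_space"
  assumes "0 < \<tau>"
  shows "has_bochner_integral lborel
    (\<lambda>t. of_real ((2 * pi) powr (- real DIM('a))) * (of_real (exp (- \<tau> * (norm t)\<^sup>2)) * iexp (x \<bullet> t)))
    (complex_of_real (heat_kernel \<tau> x))"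
proof -
  have "(2 * pi) powr (- real DIM('a)) = (4 * pi * pi) powr (- (real DIM('a) / 2))"
  proof -
    have "(4 * pi * pi) = (2 * pi) powr 2" by (simp add: powr_numeral power2_eq_square)
    then show ?thesis by (simp only: powr_powr) simp
  qed
  then have "(2 * pi) powr (- real DIM('a)) * (pi / \<tau>) powr (real DIM('a) / 2) = (4 * pi * \<tau>) powr (- (real DIM('a) / 2))"
    using assms by (simp add: powr_minus_divide powr_divide powr_mult field_simps)
  then have eq: "complex_of_real ((2 * pi) powr (- real DIM('a))) *
     of_real ((pi / \<tau>) powr (real DIM('a) / 2) * exp (- (norm x)\<^sup>2 / (4 * \<tau>))) = of_real (heat_kernel \<tau> x)"
    unfolding heat_kernel_def of_real_mult[symmetric] by (simp only: mult.assoc[symmetric])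
  from has_bochner_integral_mult_right[OF gaussian_fourier[OF assms, of x], of "of_real ((2 * pi) powr (- real DIM('a)))"]
  show ?thesis unfolding eq .
qed

lemma heat_kernel_integral:
  assumes "0 < \<tau>"
  shows "has_bochner_integral lborel (heat_kernel \<tau> :: 'a::euclidean_space \<Rightarrow> real) 1"
proof -
  let ?c = "(4 * pi * \<tau>) powr (- (real DIM('a) / 2))"
  have *: "pi / (1 / (4 * \<tau>)) = 4 * pi * \<tau>" by simp
  have "has_bochner_integral lborel (\<lambda>t::'a. of_real (exp (- (1 / (4 * \<tau>)) * (norm t)\<^sup>2)) * iexp (0 \<bullet> t))
    (complex_of_real ((4 * pi * \<tau>) powr (real DIM('a) / 2)))"
    using gaussian_fourier[of "1 / (4 * \<tau>)" "0::'a"] assms by (simp add: * mult_ac)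
  from has_bochner_integral_mult_right[of "?c", OF has_bochner_integral_Re[OF this]]
  show ?thesis
    using assms by (simp add: heat_kernel_def[abs_def] flip: powr_add)
qed

text \<open>With \<open>X = \<delta>\<^sup>2 / (4 * \<tau>)\<close> and \<open>a\<close> half the
  dimension, the kernel is at most a constant times \<open>X powr a * exp (- X)\<close>, a bounded
  function of \<open>X\<close>. The bound is uniform in \<open>\<tau>\<close> and therefore
  dominates limits as the time tends to 0.\<close>

lemma heat_kernel_bounded_away:
  assumes "0 < \<delta>"
  obtains C where "\<And>\<tau> x::'a::euclidean_space. 0 < \<tau> \<Longrightarrow> \<delta> \<le> norm x \<Longrightarrow> heat_kernel \<tau> x \<le> C"
proof
  fix \<tau> :: real and x :: 'a assume \<tau>: "0 < \<tau>" and x: "\<delta> \<le> norm x"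
  define a where "a = real DIM('a) / 2"
  have a: "0 < a" by (simp add: a_def)
  define X where "X = \<delta>\<^sup>2 / (4 * \<tau>)"
  have X: "0 < X" using assms \<tau> by (simp add: X_def)
  have "4 * pi * \<tau> = pi * \<delta>\<^sup>2 / X" using assms \<tau> by (simp add: X_def)
  then have "heat_kernel \<tau> x = (pi * \<delta>\<^sup>2 / X) powr (- a) * exp (- (norm x)\<^sup>2 / (4 * \<tau>))"
    by (simp add: heat_kernel_def a_def)
  also have "(pi * \<delta>\<^sup>2 / X) powr (- a) = (pi * \<delta>\<^sup>2) powr (- a) * X powr a"
    using assms X by (simp add: powr_divide powr_minus_divide)
  also have "exp (- (norm x)\<^sup>2 / (4 * \<tau>)) \<le> exp (- X)"
    using x \<tau> assms by (auto simp: X_def intro!: divide_right_mono power_mono)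
  finally have "heat_kernel \<tau> x \<le> (pi * \<delta>\<^sup>2) powr (- a) * (X powr a * exp (- X))"
    by (simp add: mult_left_mono mult.assoc)
  \<comment> \<open>The inequality \<open>ln z \<le> z - 1\<close> at \<open>z = X / a\<close>; the
    further gain of a factor \<open>exp (- a)\<close> is dropped.\<close>
  moreover have "X powr a * exp (- X) \<le> a powr a"
  proof -
    have "ln (X / a) \<le> X / a - 1" using X a by (intro ln_le_minus_one) simp
    then have "a * ln (X / a) \<le> a * (X / a - 1)" using a by (intro mult_left_mono) auto
    then have "a * ln X - X \<le> a * ln a" using X a by (simp add: ln_div algebra_simps)
    then have "exp (a * ln X - X) \<le> exp (a * ln a)" by simp
    then show ?thesis using X a by (simp add: powr_def exp_diff exp_minus field_simps)
  qed
  ultimately show "heat_kernel \<tau> x \<le> (pi * \<delta>\<^sup>2) powr (- (real DIM('a) / 2)) * (real DIM('a) / 2) powr (real DIM('a) / 2)"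
    unfolding a_def[symmetric] by (smt (verit) mult_left_mono powr_ge_zero)
qed

lemma heat_kernel_tendsto_0:
  fixes x :: "'a::euclidean_space"
  assumes "x \<noteq> 0"
  shows "((\<lambda>\<tau>. heat_kernel \<tau> x) \<longlongrightarrow> 0) (at_right 0)"
proof -
  have "0 < (norm x)\<^sup>2" "0 < real DIM('a)" using assms by auto
  then show ?thesis unfolding heat_kernel_def by real_asymp
qed

section \<open>Convolution with the heat kernel at small times\<close>

lemma lborel_integral_affine:
  fixes f :: "'a::euclidean_space \<Rightarrow> 'b::{banach,second_countable_topology}"
  assumes [measurable]: "f \<in> borel_measurable borel" and "c \<noteq> 0"
  shows "(LINT x|lborel. f x) = \<bar>c\<bar> ^ DIM('a) *\<^sub>R (LINT x|lborel. f (t + c *\<^sub>R x))"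
  by (subst lborel_affine[OF assms(2), of t]) (simp add: integral_density integral_distr)

text \<open>The density may be unbounded near the origin, so continuity at \<open>y\<close> is
  combined with a splitting. Inside a small ball \<open>p\<close> is bounded, and rescaling fixes
  the kernel; outside it the kernel is bounded and tends to 0 pointwise, with a multiple of the
  absolute value of \<open>p\<close> as majorant.\<close>

lemma heat_kernel_approximate_identity:
  fixes p :: "'a::euclidean_space \<Rightarrow> real"
  assumes p: "integrable lborel p" and y: "isCont p y"
    and \<epsilon>: "\<And>n. 0 < \<epsilon> n" "\<epsilon> \<longlonglongrightarrow> 0"
  shows "(\<lambda>n. LINT x|lborel. p x * heat_kernel (\<epsilon> n) (x - y)) \<longlonglongrightarrow> p y"
proof -
  have [measurable]: "p \<in> borel_measurable borel" using borel_measurable_integrable[OF p] by simp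
  obtain \<delta> where \<delta>: "0 < \<delta>" "\<And>x. dist x y < \<delta> \<Longrightarrow> dist (p x) (p y) < 1"
    using y unfolding continuous_at_eps_delta by (meson zero_less_one)
  obtain C where C: "\<And>\<tau> x::'a. 0 < \<tau> \<Longrightarrow> \<delta> \<le> norm x \<Longrightarrow> heat_kernel \<tau> x \<le> C"
    using heat_kernel_bounded_away[OF \<delta>(1)] by blast
  have C0: "0 \<le> C" 
  proof -
    obtain b :: 'a where "norm b = \<delta>" using vector_choose_size[of \<delta>] \<delta>(1) by auto
    then show ?thesis using C[of 1 b] heat_kernel_nonneg[of 1 b] by simp
  qed
  define p1 where "p1 = (\<lambda>x. indicator (ball y \<delta>) x * p x)"
  define p2 where "p2 = (\<lambda>x. indicator (- ball y \<delta>) x * p x)"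
  have [measurable]: "p1 \<in> borel_measurable borel" "p2 \<in> borel_measurable borel"
    unfolding p1_def p2_def by (auto intro!: borel_measurable_times borel_measurable_indicator)
  have p1: "\<bar>p1 x\<bar> \<le> \<bar>p y\<bar> + 1" for x
    using \<delta>(2)[of x] by (auto simp: p1_def indicator_def dist_commute dist_real_def)
  have hint: "integrable lborel (heat_kernel \<tau> :: 'a \<Rightarrow> real)" "(LINT x|lborel. heat_kernel \<tau> (x::'a)) = 1" if "0 < \<tau>" for \<tau>
    using heat_kernel_integral[OF that, where 'a='a] by (auto simp: has_bochner_integral_iff)
  \<comment> \<open>The substitution \<open>x = y + sqrt \<tau> * z\<close> moves the dependence on
    the time from the kernel into the argument of \<open>p1\<close>, where continuity at
    \<open>y\<close> handles it.\<close>
  have scale: "sqrt \<tau> ^ DIM('a) * heat_kernel \<tau> (sqrt \<tau> *\<^sub>R z) = heat_kernel 1 z" if "0 < \<tau>" for \<tau> and z :: 'a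
  proof -
    have "sqrt \<tau> ^ DIM('a) = \<tau> powr (real DIM('a) / 2)"
      using that by (simp add: powr_half_sqrt[symmetric] powr_powr flip: powr_realpow)
    moreover have "(4 * pi * \<tau>) powr (- (real DIM('a) / 2)) = (4 * pi) powr (- (real DIM('a) / 2)) * \<tau> powr (- (real DIM('a) / 2))"
      using that by (simp add: powr_mult)
    moreover have "\<tau> powr (real DIM('a) / 2) * \<tau> powr (- (real DIM('a) / 2)) = 1"
      using that by (simp flip: powr_add)
    ultimately show ?thesis
      using that by (simp add: heat_kernel_def power_mult_distrib mult_ac)
  qed
  have "(\<lambda>n. LINT z|lborel. p1 (y + sqrt (\<epsilon> n) *\<^sub>R z) * heat_kernel 1 z) \<longlonglongrightarrow> (LINT z::'a|lborel. p y * heat_kernel 1 z)"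
  proof (rule integral_dominated_convergence[where w = "\<lambda>z. (\<bar>p y\<bar> + 1) * heat_kernel 1 z"])
    show "integrable lborel (\<lambda>z::'a. (\<bar>p y\<bar> + 1) * heat_kernel 1 z)" using hint[of 1] by simp
    show "AE z in lborel. norm (p1 (y + sqrt (\<epsilon> n) *\<^sub>R z) * heat_kernel 1 z) \<le> (\<bar>p y\<bar> + 1) * heat_kernel 1 z" for n
      using p1 by (auto simp: abs_mult heat_kernel_nonneg intro!: mult_right_mono)
    show "AE z in lborel. (\<lambda>n. p1 (y + sqrt (\<epsilon> n) *\<^sub>R z) * heat_kernel 1 z) \<longlonglongrightarrow> p y * heat_kernel 1 z"
    proof (rule AE_I2, rule tendsto_mult_right)
      fix z
      have lim: "(\<lambda>n. y + sqrt (\<epsilon> n) *\<^sub>R z) \<longlonglongrightarrow> y"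
        using tendsto_add[OF tendsto_const tendsto_scaleR[OF tendsto_real_sqrt[OF \<epsilon>(2)] tendsto_const]] by simp
      have "(\<lambda>n. p (y + sqrt (\<epsilon> n) *\<^sub>R z)) \<longlonglongrightarrow> p y"
        by (rule isCont_tendsto_compose[OF y lim])
      moreover have "eventually (\<lambda>n. y + sqrt (\<epsilon> n) *\<^sub>R z \<in> ball y \<delta>) sequentially"
        using topological_tendstoD[OF lim, of "ball y \<delta>"] \<delta> by simp
      then have "eventually (\<lambda>n. p (y + sqrt (\<epsilon> n) *\<^sub>R z) = p1 (y + sqrt (\<epsilon> n) *\<^sub>R z)) sequentially"
        by eventually_elim (simp add: p1_def)
      ultimately show "(\<lambda>n. p1 (y + sqrt (\<epsilon> n) *\<^sub>R z)) \<longlonglongrightarrow> p y"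
        by (rule Lim_transform_eventually)
    qed
  qed measurable
  moreover have "(LINT x|lborel. p1 x * heat_kernel (\<epsilon> n) (x - y)) = (LINT z|lborel. p1 (y + sqrt (\<epsilon> n) *\<^sub>R z) * heat_kernel 1 z)" for n
  proof -
    have "(LINT x|lborel. p1 x * heat_kernel (\<epsilon> n) (x - y)) =
      sqrt (\<epsilon> n) ^ DIM('a) * (LINT z|lborel. p1 (y + sqrt (\<epsilon> n) *\<^sub>R z) * heat_kernel (\<epsilon> n) (sqrt (\<epsilon> n) *\<^sub>R z))"
      using \<epsilon>(1)[of n] by (subst lborel_integral_affine[where t = y and c = "sqrt (\<epsilon> n)"]) auto
    also have "\<dots> = (LINT z|lborel. p1 (y + sqrt (\<epsilon> n) *\<^sub>R z) * heat_kernel 1 z)"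
      by (simp add: mult.left_commute flip: scale[OF \<epsilon>(1)[of n]])
    finally show ?thesis .
  qed
  ultimately have 1: "(\<lambda>n. LINT x|lborel. p1 x * heat_kernel (\<epsilon> n) (x - y)) \<longlonglongrightarrow> p y"
    using hint(2)[of 1] by simp
  have le: "\<bar>p2 x * heat_kernel (\<epsilon> n) (x - y)\<bar> \<le> C * \<bar>p x\<bar>" for n x
  proof (cases "x \<in> ball y \<delta>")
    case False
    then have "heat_kernel (\<epsilon> n) (x - y) \<le> C"
      using \<epsilon>(1) by (intro C) (auto simp: dist_norm norm_minus_commute)
    then have "\<bar>p x\<bar> * heat_kernel (\<epsilon> n) (x - y) \<le> \<bar>p x\<bar> * C" by (rule mult_left_mono) simp
    then show ?thesis using False by (simp add: p2_def abs_mult heat_kernel_nonneg mult.commute)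
  qed (use C0 in \<open>auto simp: p2_def\<close>)
  have 2: "(\<lambda>n. LINT x|lborel. p2 x * heat_kernel (\<epsilon> n) (x - y)) \<longlonglongrightarrow> (LINT x::'a|lborel. 0)"
  proof (rule integral_dominated_convergence[where w = "\<lambda>x. C * \<bar>p x\<bar>"])
    show "AE x in lborel. (\<lambda>n. p2 x * heat_kernel (\<epsilon> n) (x - y)) \<longlonglongrightarrow> 0"
    proof (rule AE_I2)
      fix x
      show "(\<lambda>n. p2 x * heat_kernel (\<epsilon> n) (x - y)) \<longlonglongrightarrow> 0"
      proof (cases "x \<in> ball y \<delta>")
        case False
        then have "x - y \<noteq> 0" using \<delta>(1) by auto
        from heat_kernel_tendsto_0[OF this]
        have "(\<lambda>n. heat_kernel (\<epsilon> n) (x - y)) \<longlonglongrightarrow> 0"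
          by (rule filterlim_compose) (use \<epsilon> less_imp_neq[OF \<epsilon>(1)] in \<open>auto simp: filterlim_at intro!: always_eventually\<close>)
        then show ?thesis by (rule tendsto_mult_right_zero)
      qed (simp add: p2_def)
    qed
    show "AE x in lborel. norm (p2 x * heat_kernel (\<epsilon> n) (x - y)) \<le> C * \<bar>p x\<bar>" for n
      using le by simp
  qed (use p in \<open>auto\<close>)
  have "(LINT x|lborel. p x * heat_kernel (\<epsilon> n) (x - y)) =
     (LINT x|lborel. p1 x * heat_kernel (\<epsilon> n) (x - y)) + (LINT x|lborel. p2 x * heat_kernel (\<epsilon> n) (x - y))" for n
  proof -
    have h: "integrable lborel (\<lambda>x. heat_kernel (\<epsilon> n) (x - y))"
    proof -
      have "integrable (distr lborel borel ((+) (- y))) (heat_kernel (\<epsilon> n))"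
        by (simp add: lborel_distr_plus hint \<epsilon>)
      from integrable_distr[OF _ this] show ?thesis by simp
    qed
    have "integrable lborel (\<lambda>x. p1 x * heat_kernel (\<epsilon> n) (x - y))"
      by (rule Bochner_Integration.integrable_bound[OF integrable_mult_right[OF h, of "\<bar>p y\<bar> + 1"]])
        (use p1 in \<open>auto simp: abs_mult heat_kernel_nonneg intro!: mult_right_mono\<close>)
    moreover have "integrable lborel (\<lambda>x. p2 x * heat_kernel (\<epsilon> n) (x - y))"
      by (rule Bochner_Integration.integrable_bound[of _ "\<lambda>x. C * \<bar>p x\<bar>"])
        (use p le C0 in \<open>auto simp: abs_mult\<close>)
    moreover have "p x * heat_kernel (\<epsilon> n) (x - y) = p1 x * heat_kernel (\<epsilon> n) (x - y) + p2 x * heat_kernel (\<epsilon> n) (x - y)" for x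
      by (simp add: p1_def p2_def indicator_def)
    ultimately show ?thesis by simp
  qed
  then show ?thesis
    using tendsto_add[OF 1 2] by simp
qed


section \<open>Fubini's theorem and Fourier inversion with Gaussian damping\<close>

lemma Fubini_kernel:
  fixes K :: "'a::euclidean_space \<Rightarrow> 'b::euclidean_space \<Rightarrow> 'c::{banach,second_countable_topology}"
  assumes K: "(\<lambda>(x, y). K x y) \<in> borel_measurable (lborel \<Otimes>\<^sub>M lborel)" "\<And>x. integrable lborel (K x)"
    and N: "integrable lborel (\<lambda>x. LINT y|lborel. norm (K x y))"
  shows "(LINT y|lborel. LINT x|lborel. K x y) = (LINT x|lborel. LINT y|lborel. K x y)"
    and "integrable lborel (\<lambda>y. LINT x|lborel. K x y)"
proof -
  have i: "integrable (lborel \<Otimes>\<^sub>M lborel) (\<lambda>(x, y). K x y)"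
    by (rule lborel_pair.Fubini_integrable) (use assms in auto)
  show "(LINT y|lborel. LINT x|lborel. K x y) = (LINT x|lborel. LINT y|lborel. K x y)"
    by (rule lborel_pair.Fubini_integral[OF i])
  show "integrable lborel (\<lambda>y. LINT x|lborel. K x y)"
    by (rule lborel_pair.integrable_snd[OF i])
qed

lemma Fubini_dominated:
  fixes K :: "'a::euclidean_space \<Rightarrow> 'b::euclidean_space \<Rightarrow> 'c::{banach,second_countable_topology}"
  assumes K[measurable]: "(\<lambda>(x, y). K x y) \<in> borel_measurable (lborel \<Otimes>\<^sub>M lborel)"
    and fg: "integrable lborel f" "integrable lborel g" "\<And>x y. norm (K x y) \<le> f x * g y"
  shows "(LINT y|lborel. LINT x|lborel. K x y) = (LINT x|lborel. LINT y|lborel. K x y)"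
proof (rule Fubini_kernel(1)[OF K])
  have [measurable]: "K x \<in> borel_measurable lborel" for x
    using measurable_compose[OF _ K, of "\<lambda>y. (x, y)"] by simp
  have b: "norm (K x y) \<le> norm (f x * g y)" for x y
    using fg(3)[of x y] by (simp add: order_trans[OF _ abs_ge_self])
  show i: "integrable lborel (K x)" for x
    by (rule Bochner_Integration.integrable_bound[OF integrable_mult_right[OF fg(2), of "f x"]]) (use b in auto)
  show "integrable lborel (\<lambda>x. LINT y|lborel. norm (K x y))"
  proof (rule Bochner_Integration.integrable_bound[OF integrable_mult_left[OF fg(1), of "LINT y|lborel. g y"]])
    show "AE x in lborel. norm (LINT y|lborel. norm (K x y)) \<le> norm (f x * (LINT y|lborel. g y))"
    proof (rule AE_I2)
      fix x
      have "(LINT y|lborel. norm (K x y)) \<le> (LINT y|lborel. f x * g y)"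
        by (rule integral_mono[OF integrable_norm[OF i] integrable_mult_right[OF fg(2)] fg(3)])
      moreover have "0 \<le> (LINT y|lborel. norm (K x y))" by simp
      ultimately show "norm (LINT y|lborel. norm (K x y)) \<le> norm (f x * (LINT y|lborel. g y))"
        by simp
    qed
  qed measurable
qed

lemma heat_kernel_minus: "heat_kernel \<tau> (- x) = heat_kernel \<tau> x"
  by (simp add: heat_kernel_def)

text \<open>The transform of \<open>p\<close> may fail to be integrable. Smoothing at time
  \<open>\<epsilon>\<close> inserts the factor \<open>exp (- \<epsilon> * (norm t)\<^sup>2)\<close>,
  which makes both double integrals absolutely convergent. On the side of the mixture it adds
  \<open>\<epsilon>\<close> to every time, by the semigroup property.\<close>

lemma smoothed_density_eq_heat_mixture:
  fixes p :: "'a::euclidean_space \<Rightarrow> real" and m :: "real \<Rightarrow> real"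
  assumes p: "integrable lborel p" and m: "integrable lborel m"
    and fourier: "\<And>t. t \<noteq> 0 \<Longrightarrow> (LINT x|lborel. iexp (x \<bullet> t) * of_real (p x)) =
       of_real (LINT w|lborel. m w * exp (- exp w * (norm t)\<^sup>2))"
    and \<epsilon>: "0 < \<epsilon>"
  shows "(LINT x|lborel. p x * heat_kernel \<epsilon> (x - y)) = (LINT w|lborel. m w * heat_kernel (exp w + \<epsilon>) y)"
proof -
  have [measurable]: "p \<in> borel_measurable borel" "m \<in> borel_measurable borel"
    using borel_measurable_integrable[OF p] borel_measurable_integrable[OF m] by simp_all
  define c where "c = complex_of_real ((2 * pi) powr (- real DIM('a)))"
  define C where "C = (2 * pi) powr (- real DIM('a))"
  have gauss: "integrable lborel (\<lambda>t::'a. C * exp (- \<epsilon> * (norm t)\<^sup>2))"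
    using integrable_norm[OF integrable.intros[OF heat_kernel_fourier[OF \<epsilon>, of "0::'a"]]]
    by (simp add: norm_mult C_def)
  \<comment> \<open>Integrated over \<open>t\<close> first, \<open>K1\<close> and \<open>K2\<close>
    yield the two sides of the claim. Integrated over \<open>x\<close> and \<open>w\<close> first,
    both yield the transform of \<open>p\<close> at \<open>t\<close> times the same damped
    exponential.\<close>
  define K1 where "K1 = (\<lambda>x t. of_real (p x) * (c * (of_real (exp (- \<epsilon> * (norm t)\<^sup>2)) * iexp ((x - y) \<bullet> t))))"
  define K2 where "K2 = (\<lambda>w t. of_real (m w) * (c * (of_real (exp (- (exp w + \<epsilon>) * (norm t)\<^sup>2)) * iexp ((- y) \<bullet> t))))"
  have heat: "(LINT t|lborel. c * (of_real (exp (- \<tau> * (norm t)\<^sup>2)) * iexp (x \<bullet> t))) = complex_of_real (heat_kernel \<tau> x)"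
    if "0 < \<tau>" for \<tau> and x :: 'a
    unfolding c_def by (rule has_bochner_integral_integral_eq[OF heat_kernel_fourier[OF that]])
  have K1i: "(LINT t|lborel. K1 x t) = of_real (p x) * of_real (heat_kernel \<epsilon> (x - y))" for x
    unfolding K1_def by (subst integral_mult_right_zero) (simp only: heat[OF \<epsilon>])
  have K2i: "(LINT t|lborel. K2 w t) = of_real (m w) * of_real (heat_kernel (exp w + \<epsilon>) y)" for w
    unfolding K2_def using \<epsilon>
    by (subst integral_mult_right_zero) (simp only: heat[OF add_pos_pos[OF exp_gt_zero]] heat_kernel_minus)
  have F1: "(LINT t|lborel. LINT x|lborel. K1 x t) = (LINT x|lborel. LINT t|lborel. K1 x t)"
    by (rule Fubini_dominated[OF _ integrable_abs[OF p] gauss])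
      (simp_all add: K1_def norm_mult c_def C_def)
  have F2: "(LINT t|lborel. LINT w|lborel. K2 w t) = (LINT w|lborel. LINT t|lborel. K2 w t)"
  proof (rule Fubini_dominated[OF _ integrable_abs[OF m] gauss])
    fix w :: real and t :: 'a
    have "- (exp w + \<epsilon>) * (norm t)\<^sup>2 \<le> - \<epsilon> * (norm t)\<^sup>2" by (intro mult_right_mono) auto
    then show "norm (K2 w t) \<le> \<bar>m w\<bar> * (C * exp (- \<epsilon> * (norm t)\<^sup>2))"
      by (simp add: K2_def norm_mult c_def C_def mult_left_mono)
  qed (simp add: K2_def)
  have "complex_of_real (LINT x|lborel. p x * heat_kernel \<epsilon> (x - y)) = (LINT x|lborel. LINT t|lborel. K1 x t)"
    by (simp only: K1i of_real_mult flip: integral_complex_of_real)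
  also have "\<dots> = (LINT t|lborel. LINT x|lborel. K1 x t)" by (rule F1[symmetric])
  also have "\<dots> = (LINT t|lborel. LINT w|lborel. K2 w t)"
  proof (rule integral_cong_AE)
    show "AE t in lborel. (LINT x|lborel. K1 x t) = (LINT w|lborel. K2 w t)"
      \<comment> \<open>The transforms are assumed to agree for \<open>t \<noteq> 0\<close>, that
        is, off a null set.\<close>
      using AE_lborel_singleton[of 0]
    proof eventually_elim
      fix t :: 'a assume t: "t \<noteq> 0"
      have "(LINT x|lborel. K1 x t) = (LINT x|lborel. (c * (of_real (exp (- \<epsilon> * (norm t)\<^sup>2)) * iexp ((- y) \<bullet> t))) * (iexp (x \<bullet> t) * of_real (p x)))"
        by (rule Bochner_Integration.integral_cong) (simp_all add: K1_def inner_diff_left inner_minus_left right_diff_distrib exp_diff exp_minus field_simps)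
      also have "\<dots> = (c * (of_real (exp (- \<epsilon> * (norm t)\<^sup>2)) * iexp ((- y) \<bullet> t))) * (LINT w|lborel. of_real (m w * exp (- exp w * (norm t)\<^sup>2)))"
        unfolding integral_mult_right_zero fourier[OF t] integral_complex_of_real ..
      also have "\<dots> = (LINT w|lborel. K2 w t)"
        unfolding integral_mult_right_zero[symmetric]
        by (rule Bochner_Integration.integral_cong) (simp_all add: K2_def distrib_right exp_diff exp_minus field_simps)
      finally show "(LINT x|lborel. K1 x t) = (LINT w|lborel. K2 w t)" .
    qed
  qed (simp_all add: K1_def K2_def)
  also have "\<dots> = (LINT w|lborel. LINT t|lborel. K2 w t)" by (rule F2)
  also have "\<dots> = complex_of_real (LINT w|lborel. m w * heat_kernel (exp w + \<epsilon>) y)"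
    by (simp only: K2i of_real_mult flip: integral_complex_of_real)
  finally show ?thesis unfolding of_real_eq_iff .
qed

text \<open>The smoothing time tends to 0 in \<open>smoothed_density_eq_heat_mixture\<close>. The
  left side converges to \<open>p y\<close> by the approximate identity, the right side by dominated
  convergence, because the kernel at the fixed point \<open>y \<noteq> 0\<close> is bounded over all
  times.\<close>

lemma density_eq_heat_mixture:
  fixes p :: "'a::euclidean_space \<Rightarrow> real" and m :: "real \<Rightarrow> real"
  assumes p: "integrable lborel p" and m: "integrable lborel m"
    and fourier: "\<And>t. t \<noteq> 0 \<Longrightarrow> (LINT x|lborel. iexp (x \<bullet> t) * of_real (p x)) =
       of_real (LINT w|lborel. m w * exp (- exp w * (norm t)\<^sup>2))"
    and y: "y \<noteq> 0" "isCont p y"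
  shows "p y = (LINT w|lborel. m w * heat_kernel (exp w) y)"
    and "integrable lborel (\<lambda>w. m w * heat_kernel (exp w) y)"
proof -
  have [measurable]: "m \<in> borel_measurable borel"
    using borel_measurable_integrable[OF m] by simp
  define \<epsilon> where "\<epsilon> = (\<lambda>n. inverse (real (Suc n)))"
  have \<epsilon>: "0 < \<epsilon> n" "\<epsilon> \<longlonglongrightarrow> 0" for n
    unfolding \<epsilon>_def using LIMSEQ_inverse_real_of_nat by simp_all
  obtain C where C: "\<And>\<tau> x::'a. 0 < \<tau> \<Longrightarrow> norm y \<le> norm x \<Longrightarrow> heat_kernel \<tau> x \<le> C"
    using heat_kernel_bounded_away[of "norm y"] y by auto
  have le: "\<bar>m w * heat_kernel \<tau> y\<bar> \<le> C * \<bar>m w\<bar>" if "0 < \<tau>" for w \<tau>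
    using mult_left_mono[OF C[OF that, of y], of "\<bar>m w\<bar>"] by (simp add: abs_mult heat_kernel_nonneg mult.commute)
  have Cm: "integrable lborel (\<lambda>w. C * \<bar>m w\<bar>)" using m by simp
  show "integrable lborel (\<lambda>w. m w * heat_kernel (exp w) y)"
  proof (rule Bochner_Integration.integrable_bound[OF Cm])
    show "AE w in lborel. norm (m w * heat_kernel (exp w) y) \<le> norm (C * \<bar>m w\<bar>)"
      using le[OF exp_gt_zero] by (intro AE_I2) (metis abs_ge_self order_trans real_norm_def)
  qed simp
  have "(\<lambda>n. LINT x|lborel. p x * heat_kernel (\<epsilon> n) (x - y)) \<longlonglongrightarrow> p y"
    by (rule heat_kernel_approximate_identity[OF p y(2) \<epsilon>])
  moreover have "(LINT x|lborel. p x * heat_kernel (\<epsilon> n) (x - y)) = (LINT w|lborel. m w * heat_kernel (exp w + \<epsilon> n) y)" for n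
    by (rule smoothed_density_eq_heat_mixture[OF p m fourier \<epsilon>(1)])
  ultimately have "(\<lambda>n. LINT w|lborel. m w * heat_kernel (exp w + \<epsilon> n) y) \<longlonglongrightarrow> p y"
    by simp
  moreover have "(\<lambda>n. LINT w|lborel. m w * heat_kernel (exp w + \<epsilon> n) y) \<longlonglongrightarrow> (LINT w|lborel. m w * heat_kernel (exp w) y)"
  proof (rule integral_dominated_convergence[where w = "\<lambda>w. C * \<bar>m w\<bar>"])
    show "AE w in lborel. (\<lambda>n. m w * heat_kernel (exp w + \<epsilon> n) y) \<longlonglongrightarrow> m w * heat_kernel (exp w) y"
    proof (rule AE_I2)
      fix w
      have "(\<lambda>n. exp w + \<epsilon> n) \<longlonglongrightarrow> exp w" using tendsto_add[OF tendsto_const \<epsilon>(2), of "exp w"] by simp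
      then show "(\<lambda>n. m w * heat_kernel (exp w + \<epsilon> n) y) \<longlonglongrightarrow> m w * heat_kernel (exp w) y"
        unfolding heat_kernel_def by (intro tendsto_intros) auto
    qed
    show "AE w in lborel. norm (m w * heat_kernel (exp w + \<epsilon> n) y) \<le> C * \<bar>m w\<bar>" for n
      using le[OF add_pos_pos[OF exp_gt_zero \<epsilon>(1)]] by simp
  qed (use Cm in simp_all)
  ultimately show "p y = (LINT w|lborel. m w * heat_kernel (exp w) y)"
    by (rule LIMSEQ_unique)
qed

subsection \<open>Expansion of the density\<close>

text \<open>With \<open>v = exp u\<close> and \<open>\<tau> = exp w\<close> the kernel is
  \<open>v * \<tau> * exp (- v * \<tau>)\<close>, so this is the Laplace transform of the power
  \<open>v powr a\<close>, multiplied by \<open>\<tau>\<close>.\<close>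

lemma gumbel_exp_moment:
  fixes a w :: real
  assumes "0 \<le> a"
  shows "has_bochner_integral lborel (\<lambda>u. exp (a * u) * exp (u + w - exp (u + w))) (Gamma (a + 1) * exp (- a * w))"
proof -
  have I: "has_bochner_integral lborel (\<lambda>u. exp w * exp ((a + 1) * u - exp w * exp u)) (exp w * (Gamma (a + 1) * exp w powr (- (a + 1))))"
    using assms by (intro has_bochner_integral_mult_right exp_Gamma_integral) auto
  have lhs: "exp w * exp ((a + 1) * u - exp w * exp u) = exp (a * u) * exp (u + w - exp (u + w))" for u
    by (simp add: algebra_simps flip: exp_add)
  have rhs: "exp w * (Gamma (a + 1) * exp w powr (- (a + 1))) = Gamma (a + 1) * exp (- a * w)"
    by (simp add: powr_def algebra_simps flip: exp_add)
  show ?thesis using I unfolding lhs rhs .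
qed

text \<open>The reflection of \<open>w\<close>, that is, passing from the time to its inverse, turns
  the heat kernel into the integrand of \<open>exp_Gamma_integral\<close> with
  \<open>c = (norm y)\<^sup>2 / 4\<close>. The power of \<open>c\<close> produces the power of
  \<open>norm y\<close>.\<close>

lemma heat_kernel_exp_moment:
  fixes y :: "'a::euclidean_space"
  assumes "0 \<le> a" "y \<noteq> 0"
  shows "has_bochner_integral lborel (\<lambda>w. exp (- a * w) * heat_kernel (exp w) y)
    (pi powr (- (real DIM('a) / 2)) * 2 powr (2 * a) * Gamma (real DIM('a) / 2 + a) * norm y powr (- 2 * a - real DIM('a)))"
proof -
  define d where "d = real DIM('a) / 2"
  define r where "r = norm y"
  have d: "0 < d" and r: "0 < r" using assms by (auto simp: d_def r_def)
  have "has_bochner_integral lborel (\<lambda>w. exp ((d + a) * w - r\<^sup>2 / 4 * exp w)) (Gamma (d + a) * (r\<^sup>2 / 4) powr (- (d + a)))"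
    using assms d r by (intro exp_Gamma_integral) auto
  then have "has_bochner_integral lborel (\<lambda>w. exp ((d + a) * (0 + (-1) * w) - r\<^sup>2 / 4 * exp (0 + (-1) * w))) (Gamma (d + a) * (r\<^sup>2 / 4) powr (- (d + a)))"
    by (subst (asm) lborel_has_bochner_integral_real_affine_iff[of "-1" _ _ 0]) auto
  then have I: "has_bochner_integral lborel (\<lambda>w. (4 * pi) powr (- d) * exp ((d + a) * (0 + (-1) * w) - r\<^sup>2 / 4 * exp (0 + (-1) * w)))
      ((4 * pi) powr (- d) * (Gamma (d + a) * (r\<^sup>2 / 4) powr (- (d + a))))"
    by (rule has_bochner_integral_mult_right)
  have lhs: "(4 * pi) powr (- d) * exp ((d + a) * (0 + (-1) * w) - r\<^sup>2 / 4 * exp (0 + (-1) * w)) = exp (- a * w) * heat_kernel (exp w) y" for w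
  proof -
    have "heat_kernel (exp w) y = (4 * pi) powr (- d) * exp (- d * w) * exp (- r\<^sup>2 / 4 * exp (- w))"
    proof -
      have "(4 * pi * exp w) powr (- d) = (4 * pi) powr (- d) * exp (- d * w)"
        by (subst powr_mult) (simp_all add: powr_def)
      moreover have "- r\<^sup>2 / (4 * exp w) = - r\<^sup>2 / 4 * exp (- w)"
        by (simp add: exp_minus field_simps)
      ultimately show ?thesis by (simp only: heat_kernel_def d_def r_def)
    qed
    moreover have "exp ((d + a) * (0 + (-1) * w) - r\<^sup>2 / 4 * exp (0 + (-1) * w)) =
        exp (- a * w) * (exp (- d * w) * exp (- r\<^sup>2 / 4 * exp (- w)))"
      unfolding exp_add[symmetric] by (rule arg_cong[where f = exp]) (simp add: algebra_simps)
    ultimately show ?thesis by (simp only: mult_ac)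
  qed
  have rhs: "(4 * pi) powr (- d) * (Gamma (d + a) * (r\<^sup>2 / 4) powr (- (d + a))) =
      pi powr (- d) * 2 powr (2 * a) * Gamma (d + a) * r powr (- 2 * a - 2 * d)"
  proof -
    have 4: "(4::real) = 2 powr 2" by (simp add: powr_numeral)
    have e1: "(r\<^sup>2 / 4) powr (- (d + a)) = r powr (- 2 * a - 2 * d) * 2 powr (2 * (d + a))"
    proof -
      have "(r\<^sup>2 / 4) powr (- (d + a)) = (r powr 2 / 2 powr 2) powr (- (d + a))"
        using r by (simp add: powr_numeral)
      also have "\<dots> = r powr (2 * (- (d + a))) / 2 powr (2 * (- (d + a)))"
        using r by (subst powr_divide) (simp_all only: powr_powr powr_ge_zero)
      also have "2 * (- (d + a)) = - (2 * (d + a))" by simp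
      also have "r powr (- (2 * (d + a))) / 2 powr (- (2 * (d + a))) = r powr (- (2 * (d + a))) * 2 powr (2 * (d + a))"
        by (simp only: powr_minus divide_inverse inverse_inverse_eq)
      also have "- (2 * (d + a)) = - 2 * a - 2 * d" by simp
      finally show ?thesis .
    qed
    have e2: "(4 * pi) powr (- d) = 2 powr (- 2 * d) * pi powr (- d)"
      unfolding 4 by (subst powr_mult) (simp_all only: powr_powr powr_ge_zero pi_ge_zero, simp)
    have e3: "2 powr (- 2 * d) * 2 powr (2 * (d + a)) = (2::real) powr (2 * a)"
      by (simp flip: powr_add)
    have "(4 * pi) powr (- d) * (Gamma (d + a) * (r\<^sup>2 / 4) powr (- (d + a))) =
      pi powr (- d) * (2 powr (- 2 * d) * 2 powr (2 * (d + a))) * Gamma (d + a) * r powr (- 2 * a - 2 * d)"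
      unfolding e1 e2 by (simp only: mult_ac)
    then show ?thesis unfolding e3 .
  qed
  show ?thesis using I unfolding lhs rhs by (simp add: d_def r_def)
qed

text \<open>Integration against a nonnegative kernel preserves an expansion whose error is bounded
  by a multiple of the next term, with the same constant \<open>C\<close>. It serves once for the
  Laplace kernel and once for the heat kernel.\<close>

lemma integral_expansion_error:
  fixes f g :: "real \<Rightarrow> real" and e :: "nat \<Rightarrow> real \<Rightarrow> real"
  assumes fg: "integrable lborel (\<lambda>u. f u * g u)" and g: "\<And>u. 0 \<le> g u"
    and e: "\<And>j. j \<le> N \<Longrightarrow> has_bochner_integral lborel (\<lambda>u. e j u * g u) (I j)"
    and f: "\<And>u. \<bar>f u - (\<Sum>j<N. c j * e j u)\<bar> \<le> C * e N u"
  shows "\<bar>(LINT u|lborel. f u * g u) - (\<Sum>j<N. c j * I j)\<bar> \<le> C * I N"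
proof -
  have "has_bochner_integral lborel (\<lambda>u. f u * g u - (\<Sum>j<N. c j * (e j u * g u)))
      ((LINT u|lborel. f u * g u) - (\<Sum>j<N. c j * I j))"
    using fg e by (intro has_bochner_integral_diff has_bochner_integral_sum has_bochner_integral_mult_right
      has_bochner_integral_integrable) auto
  moreover have "f u * g u - (\<Sum>j<N. c j * (e j u * g u)) = (f u - (\<Sum>j<N. c j * e j u)) * g u" for u
    by (simp add: left_diff_distrib sum_distrib_right mult.assoc)
  ultimately have L: "has_bochner_integral lborel (\<lambda>u. (f u - (\<Sum>j<N. c j * e j u)) * g u)
      ((LINT u|lborel. f u * g u) - (\<Sum>j<N. c j * I j))"
    by simp
  have R: "has_bochner_integral lborel (\<lambda>u. C * (e N u * g u)) (C * I N)"
    using e by (intro has_bochner_integral_mult_right) auto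
  have "\<bar>LINT u|lborel. (f u - (\<Sum>j<N. c j * e j u)) * g u\<bar> \<le> (LINT u|lborel. C * (e N u * g u))"
  proof (rule order_trans[OF integral_abs_bound])
    show "(LINT u|lborel. \<bar>(f u - (\<Sum>j<N. c j * e j u)) * g u\<bar>) \<le> (LINT u|lborel. C * (e N u * g u))"
    proof (rule integral_mono)
      fix u
      show "\<bar>(f u - (\<Sum>j<N. c j * e j u)) * g u\<bar> \<le> C * (e N u * g u)"
        using mult_right_mono[OF f g, of u] by (simp add: abs_mult g mult.assoc)
    qed (use L R in \<open>auto simp: has_bochner_integral_iff\<close>)
  qed
  then show ?thesis
    unfolding has_bochner_integral_integral_eq[OF L] has_bochner_integral_integral_eq[OF R] .
qed

text \<open>The mixing density \<open>m\<close> in the variable \<open>w = log \<tau>\<close>, that is \<open>exp w * m (exp w)\<close>.\<close>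

definition mixing_weight :: "real \<Rightarrow> real \<Rightarrow> real \<Rightarrow> real" where
  "mixing_weight \<beta> \<nu> w = (LINT u|lborel. stieltjes_weight \<beta> \<nu> u * exp (u + w - exp (u + w)))"

context
  fixes \<beta> \<nu> :: real
  assumes \<beta>: "0 < \<beta>" "\<beta> < 1" and \<nu>: "0 < \<nu>"
begin

text \<open>Fubini's theorem together with the Laplace transform of an exponential, which is
  \<open>exp u / (exp u + s)\<close>. This quotient is at most 1, so integrability of the Stieltjes
  weight suffices. The case \<open>s = 0\<close> is included since it gives integrability of
  \<open>mixing_weight\<close> itself.\<close>

lemma mixing_weight_transform:
  assumes "0 \<le> s"
  shows "integrable lborel (\<lambda>w. mixing_weight \<beta> \<nu> w * exp (- exp w * s))"
    and "(LINT w|lborel. mixing_weight \<beta> \<nu> w * exp (- exp w * s)) =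
      (LINT u|lborel. stieltjes_weight \<beta> \<nu> u * (exp u / (exp u + s)))"
proof -
  have [measurable]: "stieltjes_weight \<beta> \<nu> \<in> borel_measurable borel" using \<beta> by simp
  define K where "K = (\<lambda>u w. stieltjes_weight \<beta> \<nu> u * exp (u + w - exp (u + w)) * exp (- exp w * s))"
  have ker: "has_bochner_integral lborel (\<lambda>w. exp (u + w - exp (u + w)) * exp (- exp w * s)) (exp u / (exp u + s))" for u
  proof -
    have "has_bochner_integral lborel (\<lambda>w. exp u * exp (1 * w - (exp u + s) * exp w)) (exp u * (Gamma 1 * (exp u + s) powr (- 1)))"
      using assms by (intro has_bochner_integral_mult_right exp_Gamma_integral) (auto intro: add_pos_nonneg)
    moreover have "exp u * exp (1 * w - (exp u + s) * exp w) = exp (u + w - exp (u + w)) * exp (- exp w * s)" for w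
      by (simp add: algebra_simps flip: exp_add)
    moreover have "(exp u + s) powr (- 1) = inverse (exp u + s)"
      using assms add_pos_nonneg[of "exp u" s] by (simp add: powr_minus)
    ultimately show ?thesis by (simp add: divide_inverse)
  qed
  have K: "has_bochner_integral lborel (K u) (stieltjes_weight \<beta> \<nu> u * (exp u / (exp u + s)))" for u
    using has_bochner_integral_mult_right[OF ker, of "stieltjes_weight \<beta> \<nu> u" u] by (simp add: K_def mult.assoc)
  have nK: "(LINT w|lborel. norm (K u w)) = \<bar>stieltjes_weight \<beta> \<nu> u\<bar> * (exp u / (exp u + s))" for u
    using has_bochner_integral_integral_eq[OF has_bochner_integral_mult_right[OF ker, of "\<bar>stieltjes_weight \<beta> \<nu> u\<bar>" u]]
    by (simp add: K_def abs_mult mult.assoc)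
  have int: "integrable lborel (\<lambda>u. LINT w|lborel. norm (K u w))"
    unfolding nK
  proof (rule Bochner_Integration.integrable_bound[OF stieltjes_weight_integrable[OF \<beta> \<nu>]])
    show "AE u in lborel. norm (\<bar>stieltjes_weight \<beta> \<nu> u\<bar> * (exp u / (exp u + s))) \<le> norm (stieltjes_weight \<beta> \<nu> u)"
    proof (rule AE_I2)
      fix u :: real
      have k: "exp u / (exp u + s) \<le> 1" "0 \<le> exp u / (exp u + s)"
        using assms by (auto simp: divide_le_eq add_pos_nonneg)
      show "norm (\<bar>stieltjes_weight \<beta> \<nu> u\<bar> * (exp u / (exp u + s))) \<le> norm (stieltjes_weight \<beta> \<nu> u)"
        using mult_left_mono[OF k(1) abs_ge_zero[of "stieltjes_weight \<beta> \<nu> u"]]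
        by (simp only: real_norm_def abs_mult abs_idempotent abs_of_nonneg[OF k(2)] mult_1_right)
    qed
  qed measurable
  have meas: "(\<lambda>(u, w). K u w) \<in> borel_measurable (lborel \<Otimes>\<^sub>M lborel)"
    unfolding K_def by measurable
  have M: "mixing_weight \<beta> \<nu> w * exp (- exp w * s) = (LINT u|lborel. K u w)" for w
    unfolding mixing_weight_def K_def by (rule integral_mult_left_zero[symmetric])
  note F = Fubini_kernel[OF meas integrable.intros[OF K] int]
  show "integrable lborel (\<lambda>w. mixing_weight \<beta> \<nu> w * exp (- exp w * s))"
    unfolding M by (rule F(2))
  show "(LINT w|lborel. mixing_weight \<beta> \<nu> w * exp (- exp w * s)) =
      (LINT u|lborel. stieltjes_weight \<beta> \<nu> u * (exp u / (exp u + s)))"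
    unfolding M F(1) has_bochner_integral_integral_eq[OF K] ..
qed

lemma mixing_weight_integrable: "integrable lborel (mixing_weight \<beta> \<nu>)"
  using mixing_weight_transform(1)[of 0] by simp

text \<open>A form of Watson's lemma with explicit error: \<open>stieltjes_weight_expansion\<close>
  is integrated term by term, and no cutoff arises because its bound holds for all
  \<open>u\<close>.\<close>

lemma mixing_weight_expansion:
  assumes "0 < N"
  shows "\<bar>mixing_weight \<beta> \<nu> w -
      (\<Sum>j<N. - ((- 1) ^ j) * pochhammer \<nu> j / fact j * sin (pi * \<beta> * j) / pi * (Gamma (\<beta> * j + 1) * exp (- (\<beta> * j) * w)))\<bar>
    \<le> pochhammer \<nu> N / fact N * sin (pi * \<beta>) powr (- (\<nu> + N)) / pi * (Gamma (\<beta> * N + 1) * exp (- (\<beta> * N) * w))"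
  unfolding mixing_weight_def
proof (rule integral_expansion_error[where e = "\<lambda>j u. exp (\<beta> * real j * u)"])
  have [measurable]: "stieltjes_weight \<beta> \<nu> \<in> borel_measurable borel" using \<beta> by simp
  show "integrable lborel (\<lambda>u. stieltjes_weight \<beta> \<nu> u * exp (u + w - exp (u + w)))"
  proof (rule Bochner_Integration.integrable_bound[OF stieltjes_weight_integrable[OF \<beta> \<nu>]])
    show "AE u in lborel. norm (stieltjes_weight \<beta> \<nu> u * exp (u + w - exp (u + w))) \<le> norm (stieltjes_weight \<beta> \<nu> u)"
    proof (rule AE_I2)
      fix u :: real
      have "u + w \<le> exp (u + w)" using exp_ge_add_one_self[of "u + w"] by linarith
      then show "norm (stieltjes_weight \<beta> \<nu> u * exp (u + w - exp (u + w))) \<le> norm (stieltjes_weight \<beta> \<nu> u)"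
        by (simp add: abs_mult mult_left_le)
    qed
  qed measurable
  show "has_bochner_integral lborel (\<lambda>u. exp (\<beta> * real j * u) * exp (u + w - exp (u + w)))
      (Gamma (\<beta> * real j + 1) * exp (- (\<beta> * real j) * w))" for j
    using \<beta> by (intro gumbel_exp_moment) simp
qed (use stieltjes_weight_expansion[OF \<beta> \<nu> assms] in \<open>simp_all only: exp_ge_zero\<close>)

text \<open>The first conclusion shows that \<open>p y\<close> depends on \<open>y\<close> through
  its norm only. The second integrates \<open>mixing_weight_expansion\<close> against the heat
  kernel, with \<open>H j\<close> as the result of both integrations of the j-th power.\<close>

lemma density_expansion:
  fixes p :: "'a::euclidean_space \<Rightarrow> real"
  assumes p: "integrable lborel p" and N: "0 < N" and y: "y \<noteq> 0" "isCont p y"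
    and fourier: "\<And>t. (LINT x|lborel. iexp (x \<bullet> t) * of_real (p x)) = of_real ((1 + norm t powr (2 * \<beta>)) powr (- \<nu>))"
  defines "H \<equiv> \<lambda>j::nat. Gamma (\<beta> * j + 1) *
      (pi powr (- (real DIM('a) / 2)) * 2 powr (2 * (\<beta> * j)) * Gamma (real DIM('a) / 2 + \<beta> * j) * norm y powr (- 2 * (\<beta> * j) - real DIM('a)))"
  shows "p y = (LINT w|lborel. mixing_weight \<beta> \<nu> w * heat_kernel (exp w) y)"
    and "\<bar>p y - (\<Sum>j<N. - ((- 1) ^ j) * pochhammer \<nu> j / fact j * sin (pi * \<beta> * j) / pi * H j)\<bar>
      \<le> pochhammer \<nu> N / fact N * sin (pi * \<beta>) powr (- (\<nu> + N)) / pi * H N"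
proof -
  have four: "(LINT x|lborel. iexp (x \<bullet> t) * of_real (p x)) =
       of_real (LINT w|lborel. mixing_weight \<beta> \<nu> w * exp (- exp w * (norm t)\<^sup>2))" if "t \<noteq> 0" for t
  proof -
    have "(norm t)\<^sup>2 powr \<beta> = norm t powr (2 * \<beta>)"
      using that by (simp add: powr_powr flip: powr_numeral)
    then have "(LINT w|lborel. mixing_weight \<beta> \<nu> w * exp (- exp w * (norm t)\<^sup>2)) = (1 + norm t powr (2 * \<beta>)) powr (- \<nu>)"
      using mixing_weight_transform(2)[of "(norm t)\<^sup>2"] stieltjes_representation[OF \<beta> \<nu>, of "(norm t)\<^sup>2"] that by simp
    then show ?thesis by (simp only: fourier)
  qed
  note mix = density_eq_heat_mixture[OF p mixing_weight_integrable four y]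
  show py: "p y = (LINT w|lborel. mixing_weight \<beta> \<nu> w * heat_kernel (exp w) y)"
    by (rule mix(1))
  show "\<bar>p y - (\<Sum>j<N. - ((- 1) ^ j) * pochhammer \<nu> j / fact j * sin (pi * \<beta> * j) / pi * H j)\<bar>
      \<le> pochhammer \<nu> N / fact N * sin (pi * \<beta>) powr (- (\<nu> + N)) / pi * H N"
    unfolding py
  proof (rule integral_expansion_error[where e = "\<lambda>j w. Gamma (\<beta> * real j + 1) * exp (- (\<beta> * real j) * w)"])
    fix j :: nat
    have "0 \<le> \<beta> * real j" using \<beta> by simp
    from has_bochner_integral_mult_right[OF heat_kernel_exp_moment[OF this y(1)], of "Gamma (\<beta> * j + 1)"]
    show "has_bochner_integral lborel (\<lambda>w. Gamma (\<beta> * real j + 1) * exp (- (\<beta> * real j) * w) * heat_kernel (exp w) y) (H j)"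
      by (simp only: H_def mult.assoc)
  qed (use mixing_weight_expansion[OF N] mix(2) heat_kernel_nonneg in auto)
qed

end

text \<open>The factor \<open>1 / pi\<close> of the Stieltjes weight merges with
  \<open>pi powr (- n / 2)\<close> of the heat kernel, and the Pochhammer symbol becomes a quotient
  of Gamma values.\<close>

lemma Gamma_expansion_coefficient:
  fixes \<alpha> \<nu> r :: real and n j :: nat
  assumes "0 < \<nu>"
  shows "pochhammer \<nu> j / fact j / pi * (Gamma (\<alpha> / 2 * j + 1) *
      (pi powr (- (real n / 2)) * 2 powr (2 * (\<alpha> / 2 * j)) * Gamma (real n / 2 + \<alpha> / 2 * j) * r powr (- 2 * (\<alpha> / 2 * j) - real n))) =
    1 / pi powr ((real n + 2) / 2) * (1 / fact j * (Gamma (\<nu> + real j) / Gamma \<nu>) * 2 powr (\<alpha> * real j) *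
      Gamma ((real n + \<alpha> * real j) / 2) * Gamma ((2 + \<alpha> * real j) / 2) * r powr (- \<alpha> * real j - real n))"
proof -
  have poch: "pochhammer \<nu> j = Gamma (\<nu> + real j) / Gamma \<nu>"
    using assms by (intro pochhammer_Gamma) (auto elim!: nonpos_Ints_cases)
  have e1: "pi powr (- (real n / 2)) / pi = 1 / pi powr ((real n + 2) / 2)"
  proof -
    have "pi powr ((real n + 2) / 2) = pi powr (real n / 2) * pi"
      by (simp add: add_divide_distrib powr_add)
    then show ?thesis by (simp add: powr_minus_divide)
  qed
  have e2: "Gamma (\<alpha> / 2 * j + 1) = Gamma ((2 + \<alpha> * real j) / 2)"
    "Gamma (real n / 2 + \<alpha> / 2 * j) = Gamma ((real n + \<alpha> * real j) / 2)"
    by (simp_all add: add_divide_distrib add.commute)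
  have e3: "pochhammer \<nu> j / fact j / pi * (a * (P * b * c * d)) = P / pi * (1 / fact j * pochhammer \<nu> j * b * c * a * d)"
    for a P b c d :: real by (simp add: mult_ac)
  show ?thesis
    unfolding e2 e3 e1 poch[symmetric] by simp
qed

theorem proposition3p4:
  fixes p :: "real ^ 'n \<Rightarrow> real" and q :: "real \<Rightarrow> real" and \<alpha> \<nu> :: real and n :: nat
  defines "n \<equiv> CARD('n)"
  defines "q \<equiv> radial_part p"
  assumes "0 < \<alpha>" and "\<alpha> < 2" and "0 < \<nu>"
    and "linnik_density \<alpha> \<nu> p"
  shows "(\<forall>N::nat. N \<ge> 1 \<longrightarrow>
           (\<exists>R :: real \<Rightarrow> real. \<forall>\<^sub>F r in at_top.
              q r = 1 / pi powr ((real n + 2) / 2) *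
                      (\<Sum>j = 1..N - 1. (- 1) ^ (j - 1) / fact j * (Gamma (\<nu> + real j) / Gamma \<nu>) *
                         sin (pi * \<alpha> * real j / 2) * 2 powr (\<alpha> * real j) *
                         Gamma ((real n + \<alpha> * real j) / 2) * Gamma ((2 + \<alpha> * real j) / 2) *
                         r powr (- \<alpha> * real j - real n))
                    + R r \<and>
              \<bar>R r\<bar> \<le> 2 powr (\<alpha> * real N) * Gamma (real N + \<nu>) *
                         Gamma ((real n + \<alpha> * real N) / 2) * Gamma ((2 + \<alpha> * real N) / 2) /
                         (pi powr ((real n + 2) / 2) * fact N * Gamma \<nu> *
                          sin (pi * \<alpha> / 2) powr (\<nu> + real N)) *
                         r powr (- \<alpha> * real N - real n))) \<and>
         q \<sim>[at_top]
           (\<lambda>r. 2 powr \<alpha> * \<nu> / pi powr ((real n + 2) / 2) * sin (pi * \<alpha> / 2) *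
                Gamma ((real n + \<alpha>) / 2) * Gamma ((2 + \<alpha>) / 2) * r powr (- \<alpha> - real n))"
proof -
  define \<beta> where "\<beta> = \<alpha> / 2"
  have \<beta>: "0 < \<beta>" "\<beta> < 1" and \<nu>: "0 < \<nu>" using assms by (auto simp: \<beta>_def)
  have \<alpha>: "2 * \<beta> = \<alpha>" by (simp add: \<beta>_def)
  have ld: "p \<in> borel_measurable lborel" "\<And>x. 0 \<le> p x" "prob_space (density lborel (\<lambda>x. ennreal (p x)))"
    "\<And>t. (LINT x|lborel. iexp (x \<bullet> t) * of_real (p x)) = of_real ((1 + norm t powr (2 * \<beta>)) powr (- \<nu>))"
    "continuous_on (- {0}) p"
    using assms(6) unfolding linnik_density_def \<alpha> by simp_all
  have p: "integrable lborel p"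
  proof (rule integrableI_nonneg)
    interpret P: prob_space "density lborel (\<lambda>x. ennreal (p x))" by fact
    have "emeasure (density lborel (\<lambda>x. ennreal (p x))) UNIV = 1"
      using P.emeasure_space_1 by simp
    then show "(\<integral>\<^sup>+ x. ennreal (p x) \<partial>lborel) < \<infinity>"
      using ld(1) by (simp add: emeasure_density)
  qed (use ld in auto)
  have cont: "isCont p y" if "y \<noteq> 0" for y
    using ld(5) that continuous_on_eq_continuous_at[of "- {0}" p] by (simp add: open_Compl)
  define T where "T = (\<lambda>r (j::nat). Gamma (\<beta> * j + 1) * (pi powr (- (real n / 2)) * 2 powr (2 * (\<beta> * j)) *
      Gamma (real n / 2 + \<beta> * j) * r powr (- 2 * (\<beta> * j) - real n)))"
  have q: "\<bar>q r - (\<Sum>j<N. - ((- 1) ^ j) * pochhammer \<nu> j / fact j * sin (pi * \<beta> * j) / pi * T r j)\<bar>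
      \<le> pochhammer \<nu> N / fact N * sin (pi * \<beta>) powr (- (\<nu> + N)) / pi * T r N" if r: "0 < r" and N: "0 < N" for r N
  proof -
    obtain y :: "real ^ 'n" where y: "norm y = r" using vector_choose_size[of r] r by auto
    have nz: "x \<noteq> 0" if "norm x = r" for x :: "real ^ 'n" using that r by auto
    \<comment> \<open>The mixture formula makes \<open>p\<close> constant on the sphere, which is
      nonempty, so the definite description in \<open>radial_part\<close> denotes this
      value.\<close>
    have const: "p x = p y" if "norm x = r" for x
      unfolding density_expansion(1)[OF \<beta> \<nu> p N nz[OF that] cont[OF nz[OF that]] ld(4)]
        density_expansion(1)[OF \<beta> \<nu> p N nz[OF y] cont[OF nz[OF y]] ld(4)]
      by (simp add: heat_kernel_def that y)
    have "q r = p y"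
      unfolding q_def radial_part_def
    proof (rule the_equality)
      show "\<forall>x. norm x = r \<longrightarrow> p x = p y" using const by simp
      show "z = p y" if "\<forall>x. norm x = r \<longrightarrow> p x = z" for z using that y by simp
    qed
    then show ?thesis
      using density_expansion(2)[OF \<beta> \<nu> p N nz[OF y] cont[OF nz[OF y]] ld(4)] y by (simp add: T_def n_def)
  qed
  note coeff = Gamma_expansion_coefficient[OF \<nu>, where \<alpha> = \<alpha> and n = n, folded \<beta>_def, folded fun_cong[OF fun_cong[OF T_def]]]
  define S where "S = (\<lambda>N r. 1 / pi powr ((real n + 2) / 2) *
                      (\<Sum>j = 1..N - 1. (- 1) ^ (j - 1) / fact j * (Gamma (\<nu> + real j) / Gamma \<nu>) *
                         sin (pi * \<alpha> * real j / 2) * 2 powr (\<alpha> * real j) *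
                         Gamma ((real n + \<alpha> * real j) / 2) * Gamma ((2 + \<alpha> * real j) / 2) *
                         r powr (- \<alpha> * real j - real n)))"
  define E where "E = (\<lambda>N. 2 powr (\<alpha> * real N) * Gamma (real N + \<nu>) *
                         Gamma ((real n + \<alpha> * real N) / 2) * Gamma ((2 + \<alpha> * real N) / 2) /
                         (pi powr ((real n + 2) / 2) * fact N * Gamma \<nu> *
                          sin (pi * \<alpha> / 2) powr (\<nu> + real N)))"
  have main: "\<bar>q r - S N r\<bar> \<le> E N * r powr (- \<alpha> * real N - real n)" if r: "0 < r" and N: "0 < N" for r N
  proof -
    \<comment> \<open>The term \<open>j = 0\<close> carries \<open>sin 0\<close>, so the sum may
      start at 1; for \<open>N = 1\<close> it becomes the empty sum.\<close>
    have "(\<Sum>j<N. - ((- 1) ^ j) * pochhammer \<nu> j / fact j * sin (pi * \<beta> * j) / pi * T r j) =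
       (\<Sum>j = 1..N - 1. - ((- 1) ^ j) * pochhammer \<nu> j / fact j * sin (pi * \<beta> * j) / pi * T r j)"
    proof (rule sum.mono_neutral_right)
      show "\<forall>j\<in>{..<N} - {1..N - 1}. - ((- 1) ^ j) * pochhammer \<nu> j / fact j * sin (pi * \<beta> * j) / pi * T r j = 0"
        by (auto simp: not_le)
    qed auto
    also have "\<dots> = (\<Sum>j = 1..N - 1. - ((- 1) ^ j) * sin (pi * \<beta> * j) * (pochhammer \<nu> j / fact j / pi * T r j))"
      by (simp add: mult_ac)
    also have "\<dots> = S N r"
      unfolding S_def sum_distrib_left
    proof (rule sum.cong[OF refl])
      fix j assume j: "j \<in> {1..N - 1}"
      then obtain i where "j = Suc i" by (cases j) auto
      then have sgn: "- ((- 1) ^ j) = (- 1 :: real) ^ (j - 1)" by simp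
      have ang: "pi * \<beta> * j = pi * \<alpha> * real j / 2" by (simp add: \<beta>_def mult_ac)
      show "- ((- 1) ^ j) * sin (pi * \<beta> * j) * (pochhammer \<nu> j / fact j / pi * T r j) =
        1 / pi powr ((real n + 2) / 2) * ((- 1) ^ (j - 1) / fact j * (Gamma (\<nu> + real j) / Gamma \<nu>) *
                         sin (pi * \<alpha> * real j / 2) * 2 powr (\<alpha> * real j) *
                         Gamma ((real n + \<alpha> * real j) / 2) * Gamma ((2 + \<alpha> * real j) / 2) *
                         r powr (- \<alpha> * real j - real n))"
        unfolding coeff sgn ang by simp
    qed
    finally have 1: "(\<Sum>j<N. - ((- 1) ^ j) * pochhammer \<nu> j / fact j * sin (pi * \<beta> * j) / pi * T r j) = S N r" .
    have "pochhammer \<nu> N / fact N * sin (pi * \<beta>) powr (- (\<nu> + N)) / pi * T r N =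
       sin (pi * \<beta>) powr (- (\<nu> + N)) * (pochhammer \<nu> N / fact N / pi * T r N)"
      by simp
    also have "\<dots> = E N * r powr (- \<alpha> * real N - real n)"
      unfolding coeff E_def powr_minus_divide[of "sin (pi * \<beta>)"] by (simp add: \<beta>_def add.commute mult_ac)
    finally show ?thesis using q[OF r N] 1 by simp
  qed
  have "\<exists>R. \<forall>\<^sub>F r in at_top. q r = S N r + R r \<and> \<bar>R r\<bar> \<le> E N * r powr (- \<alpha> * real N - real n)" if "1 \<le> N" for N
  proof (rule exI[of _ "\<lambda>r. q r - S N r"])
    show "\<forall>\<^sub>F r in at_top. q r = S N r + (q r - S N r) \<and> \<bar>q r - S N r\<bar> \<le> E N * r powr (- \<alpha> * real N - real n)"
      using eventually_gt_at_top[of "0::real"]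
    proof eventually_elim
      case (elim r)
      then show ?case using main[of r N] that by simp
    qed
  qed
  moreover have "q \<sim>[at_top] (\<lambda>r. 2 powr \<alpha> * \<nu> / pi powr ((real n + 2) / 2) * sin (pi * \<alpha> / 2) *
                Gamma ((real n + \<alpha>) / 2) * Gamma ((2 + \<alpha>) / 2) * r powr (- \<alpha> - real n))" (is "_ \<sim>[at_top] ?l")
  proof -
    define A where "A = 2 powr \<alpha> * \<nu> / pi powr ((real n + 2) / 2) * sin (pi * \<alpha> / 2) *
                Gamma ((real n + \<alpha>) / 2) * Gamma ((2 + \<alpha>) / 2)"
    have "0 < sin (pi * \<alpha> / 2)" using assms by (intro sin_gt_zero) auto
    moreover have "0 < Gamma ((real n + \<alpha>) / 2)" "0 < Gamma ((2 + \<alpha>) / 2)"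
      using assms by (auto intro!: Gamma_real_pos divide_pos_pos add_nonneg_pos)
    ultimately have A: "0 < A" unfolding A_def using \<nu> by simp
    have "\<nu> \<notin> \<int>\<^sub>\<le>\<^sub>0" using \<nu> by (auto elim!: nonpos_Ints_cases)
    then have "Gamma (\<nu> + 1) = \<nu> * Gamma \<nu>" "Gamma \<nu> \<noteq> 0"
      using Gamma_plus1[of \<nu>] Gamma_real_pos[OF \<nu>] by simp_all
    then have S2: "S 2 r = A * r powr (- \<alpha> - real n)" for r
      by (simp add: S_def A_def)
    \<comment> \<open>The case \<open>N = 2\<close> has the leading term as its whole sum, and its
      error is smaller by the factor \<open>r powr (- \<alpha>)\<close>.\<close>
    have "(\<lambda>r. q r - A * r powr (- \<alpha> - real n)) \<in> O(\<lambda>r. r powr (- \<alpha> * 2 - real n))"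
    proof (rule bigoI[of _ "E 2"])
      show "\<forall>\<^sub>F r in at_top. norm (q r - A * r powr (- \<alpha> - real n)) \<le> E 2 * norm (r powr (- \<alpha> * 2 - real n))"
        using eventually_gt_at_top[of "0::real"]
      proof eventually_elim
        case (elim r)
        then show ?case using main[of r 2] by (simp add: S2)
      qed
    qed
    also have "(\<lambda>r. r powr (- \<alpha> * 2 - real n)) \<in> o(\<lambda>r. A * r powr (- \<alpha> - real n))"
      using A assms(3) by real_asymp
    finally show ?thesis
      unfolding A_def[symmetric] by (intro smallo_imp_asymp_equiv) simp
  qed
  ultimately show ?thesis
    unfolding S_def E_def by blast
qed

end
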